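(* Assume (A1)–(A5) and let $(y_n)$ be the iterates with adapted step sizes $y_{n+1}=y_n+\frac{a(n)}{g(y_n)}[h(y_n)+M_{n+1}]$ (all as specified in the context). Then, almost surely, $(y_n)$ converges to a (possibly sample-path dependent) internally chain transitive set of the o.d.e. $\dot x(t)=h(x(t))$.
   Context: Setting. $h:\mathbb R^d\to\mathbb R^d$, $(a(n))_{n\ge0}$ are positive deterministic step sizes, $W:\mathbb R^d\to[0,\infty)$ is continuously differentiable, and $y_0$ is an $\mathbb R^d$-valued random vector. $(M_n)_{n\ge1}$ are $\mathbb R^d$-valued random vectors, and $\mathcal F_n=\sigma(y_0,M_1,\dots,M_n)$. (A1) $h$ is locally Lipschitz. (A2) (i) $\sum_n a(n)=\infty$; (ii) $\sum_n a(n)^2<\infty$. (A3) (i) $E[M_{n+1}\mid\mathcal F_n]=0$ a.s. for all $n\ge0$; (ii) each $M_n$ is square integrable and there is a locally bounded measurable $f:\mathbb R^d\to[0,\infty)$ with $E[\|M_{n+1}\|^2\mid\mathcal F_n]\le f(y_n)$ a.s. for all $n\ge0$. (A4) (i) $W\ge0$ and $W(x)\to\infty$ as $\|x\|\to\infty$; (ii) $M$ is a positive integer such that $h(x)\cdot\nabla W(x)<0$ whenever $W(x)\ge M$. (A5) $W$ is twice continuously differentiable and all its second order derivatives are bounded in absolute value by a constant. (Under (A1) and (A4) the o.d.e. has a unique solution for all $t\ge0$ from every initial point.) For real $r$, $H^r:=\{x:W(x)<r\}$ and $\bar H^r$ is its closure; $H^\infty=\bar H^\infty=\mathbb R^d$.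 Choice of $N$ and $g$. $N$ is a positive integer or $\infty$, with $M<N\le\infty$, such that there is a finite constant $c_N>\max\left(1,\sup_{y\in\bar H^N\setminus H^M}\frac{\|h(y)\|^2+f(y)}{W(y)}\right)$ (this always holds for finite $N$). $g:\mathbb R^d\to\mathbb R$ is a locally bounded measurable function with $g(y)\ge\max\left(1,\ \mathbb I\{W(y)>N\}\sqrt{\frac{\|h(y)\|^2+f(y)}{W(y)}}\right)$ for all $y$ (the second term being $0$ when $W(y)\le N$). Iterates: $y_{n+1}=y_n+a^\omega(n)[h(y_n)+M_{n+1}]$ for $n\ge0$, where $a^\omega(n):=a(n)/g(y_n)$. Internally chain transitive set: a nonempty closed set $A\subset\mathbb R^d$ that is invariant (for every $x\in A$ the solution of the o.d.e. through $x$ at time $0$ is defined for all $t\in\mathbb R$ and stays in $A$) and such that for all $x,x'\in A$, $\epsilon>0$ and $T>0$ there are $n\ge1$ and points $x_0=x,x_1,\dots,x_n=x'$ in $A$ such that, for each $0\le i<n$, the solution of the o.d.e. started at $x_i$ lies in the $\epsilon$-neighbourhood of $x_{i+1}$ at some time $\ge T$. Convergence of $(y_n)$ to a set $A$ means that the distance from $y_n$ to $A$ tends to $0$. *)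

theory Defs
  imports "HOL-Probability.Probability"
begin

definition locally_bounded :: "('a::metric_space \<Rightarrow> 'b::metric_space) \<Rightarrow> bool" where
  "locally_bounded f \<longleftrightarrow> (\<forall>x. \<exists>e>0. bounded (f ` ball x e))"

text \<open>The level \<open>r\<close> is an extended real, so that level \<open>\<infinity>\<close> gives the whole space.\<close>

definition sublevel :: "('a \<Rightarrow> real) \<Rightarrow> ereal \<Rightarrow> 'a set" where
  "sublevel W r = {x. ereal (W x) < r}"

text \<open>The sigma-algebra generated by \<open>y0, M 1, \<dots>, M n\<close>; the value \<open>M 0\<close> is not used.\<close>

definition noise_filtration ::
  "'w measure \<Rightarrow> ('w \<Rightarrow> 'a::topological_space) \<Rightarrow> (nat \<Rightarrow> 'w \<Rightarrow> 'a) \<Rightarrow> nat \<Rightarrow> 'w measure" where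
  "noise_filtration P y0 M n = sigma (space P)
     ({y0 -` B \<inter> space P | B. B \<in> sets borel} \<union>
      (\<Union>k\<in>{1..n}. {M k -` B \<inter> space P | B. B \<in> sets borel}))"

definition ode_solution ::
  "('a::real_normed_vector \<Rightarrow> 'a) \<Rightarrow> real set \<Rightarrow> (real \<Rightarrow> 'a) \<Rightarrow> 'a \<Rightarrow> bool" where
  "ode_solution h T \<phi> x \<longleftrightarrow>
     \<phi> 0 = x \<and> (\<forall>t\<in>T. (\<phi> has_vector_derivative h (\<phi> t)) (at t within T))"

text \<open>For locally Lipschitz \<open>h\<close> solutions are unique, so the existential quantifiers over \<open>\<phi>\<close>
  below speak about \<^emph>\<open>the\<close> solution.\<close>

definition ode_invariant :: "('a::real_normed_vector \<Rightarrow> 'a) \<Rightarrow> 'a set \<Rightarrow> bool" where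
  "ode_invariant h A \<longleftrightarrow>
     (\<forall>x\<in>A. \<exists>\<phi>. ode_solution h UNIV \<phi> x \<and> (\<forall>t. \<phi> t \<in> A))"

definition internally_chain_transitive :: "('a::real_normed_vector \<Rightarrow> 'a) \<Rightarrow> 'a set \<Rightarrow> bool" where
  "internally_chain_transitive h A \<longleftrightarrow>
     A \<noteq> {} \<and> closed A \<and> ode_invariant h A \<and>
     (\<forall>x\<in>A. \<forall>x'\<in>A. \<forall>\<epsilon>>0. \<forall>T>0. \<exists>n\<ge>1. \<exists>p :: nat \<Rightarrow> 'a.
        p 0 = x \<and> p n = x' \<and> (\<forall>i\<le>n. p i \<in> A) \<and>
        (\<forall>i<n. \<exists>\<phi>. ode_solution h {0..} \<phi> (p i) \<and> (\<exists>t\<ge>T. dist (\<phi> t) (p (Suc i)) < \<epsilon>)))"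

end

theory Submission
  imports Defs
begin

text \<open>
  A huber function of \<open>W - m\<close> has a globally controlled second order remainder, grows like \<open>W\<close>, and
  does not increase along the o.d.e., not even below the level \<open>m\<close>. Since the step \<open>a n / g (y n)\<close>
  makes the expected quadratic error of one step at most a constant times \<open>(a n)\<^sup>2 * (1 + W (y n))\<close>,
  this function divided by the convergent products of \<open>1 + Q * (a j)\<^sup>2\<close> is a nonnegative
  supermartingale, so almost every path is bounded. On the event that the path stays in a ball,
  the martingale sum with steps cut off outside that ball coincides with the accumulated noise, and it
  converges by the maximal inequality applied to its squared increments plus the tail of their
  variance bounds. What remains is deterministic: a bounded Euler scheme with summable noise and square
  summable steps of infinite total length shadows the flow over bounded time windows that start late,
  and this makes its set of cluster points internally chain transitive.
\<close>

section \<open>Globally Lipschitz differential equations\<close>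

text \<open>Below the level \<open>m\<close> nothing is known about the sign of the drift of
  \<open>W\<close>. There it contributes terms of order \<open>a n\<close>, whose sum diverges, so
  \<open>W\<close> itself is not close to a supermartingale. A test function should be flat below
  \<open>m\<close>, but the kink of \<open>max 0 (W - m)\<close> would cost an error linear in the
  step near the level \<open>m\<close>. The huber function is flat below \<open>m\<close>, has slope
  one in \<open>W\<close> above \<open>m + 1\<close>, and a Lipschitz slope in between, so only
  quadratic errors remain, and these are summable. The price is a bound for the gradient of
  \<open>W\<close> where the slope varies; it follows from \<open>W\<close> being nonnegative with
  bounded Hessian. The initial value need not be integrable. Supermartingale inequalities are
  therefore stated as nonnegative integrals over events of the past, and boundedness of paths is
  proved on events where the initial value of the supermartingale is bounded. The field
  \<open>h\<close> is merely locally Lipschitz. Flows are built for bounded, globally Lipschitz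
  fields, and \<open>h\<close> is replaced by such a field path by path, once the path is known to
  be bounded.\<close>

lemma lipschitz_bounded_ode_forward:
  fixes F :: "'a::euclidean_space \<Rightarrow> 'a"
  assumes L: "L > 0" and lip: "L-lipschitz_on UNIV F" and B: "\<And>x. norm (F x) \<le> B"
  shows "\<exists>\<phi>. ode_solution F {0..} \<phi> x"
proof -
  \<comment> \<open>Bounded continuous functions live on the whole real line; cutting the time at 0
    extends the half-line problem constantly to negative times.\<close>
  define p :: "real \<Rightarrow> real" where "p t = max 0 t" for t
  define k where "k G s = F (exp (2 * L * s) *\<^sub>R apply_bcontfun G s)" for G :: "real \<Rightarrow>\<^sub>C 'a" and s
  \<comment> \<open>The Picard operator, conjugated by the weight \<open>exp (- 2 * L * t)\<close>, is a contraction on all of the half line.\<close>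
  define H where "H G t = exp (- 2 * L * p t) *\<^sub>R (x + integral {0..p t} (k G))" for G t
  have p0: "p t \<ge> 0" for t by (simp add: p_def)
  have B0: "B \<ge> 0" using B[of 0] norm_ge_zero[of "F 0"] by linarith
  have contF: "continuous_on UNIV F"
    using lip lipschitz_on_continuous_on by blast
  have contk: "continuous_on T (k G)" for G T
    unfolding k_def
    by (intro continuous_on_compose2[OF contF]) (auto intro!: continuous_intros)
  have deriv: "((\<lambda>t. integral {0..t} (k G)) has_vector_derivative k G t) (at t within {0..})"
    if "t \<ge> 0" for G t
  proof -
    have "((\<lambda>t. integral {0..t} (k G)) has_vector_derivative k G t) (at t within {0..t+1})"
      by (rule integral_has_vector_derivative) (use that contk in auto)
    moreover have "at t within {0..t+1} = at t within {0..}"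
      by (rule at_within_nhd[of t "{..<t+1}"]) auto
    ultimately show ?thesis by simp
  qed
  have contI: "continuous_on {0..} (\<lambda>t. integral {0..t} (k G))" for G
    by (rule continuous_on_vector_derivative) (use deriv in auto)
  have contH: "continuous_on UNIV (H G)" for G
    unfolding H_def
    by (intro continuous_intros continuous_on_compose2[OF contI])
       (auto simp: p_def intro!: continuous_intros)
  have normk: "norm (k G s) \<le> B" for G s by (simp add: k_def B)
  have intk: "k G integrable_on {0..t}" for G t
    by (rule integrable_continuous_interval[OF contk])
  have normI: "norm (integral {0..t} (k G)) \<le> B * t" if "t \<ge> 0" for G t
    using integral_bound[of 0 t "k G" B] that contk normk by simp
  have normH: "norm (H G t) \<le> norm x + B / (2 * L)" for G t
  proof -
    have e1: "exp (- 2 * L * p t) \<le> 1" using L p0[of t] by simp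
    \<comment> \<open>The integral may grow linearly in time. The exponential weight dominates that
      growth, so the image has a bound that does not depend on \<open>G\<close>.\<close>
    have "exp (2 * L * p t) \<ge> 1 + 2 * L * p t" by (rule exp_ge_add_one_self)
    then have "2 * L * p t \<le> exp (2 * L * p t)" by linarith
    then have e2: "exp (- 2 * L * p t) * (2 * L * p t) \<le> 1"
      by (simp add: exp_minus field_simps)
    have "norm (H G t) \<le> exp (- 2 * L * p t) * (norm x + B * p t)"
      unfolding H_def using norm_triangle_ineq[of x "integral {0..p t} (k G)"] normI[OF p0, of t G]
      by simp
    also have "\<dots> = exp (- 2 * L * p t) * norm x + (exp (- 2 * L * p t) * (2 * L * p t)) * (B / (2 * L))"
      using L by (simp add: field_simps)
    also have "\<dots> \<le> 1 * norm x + 1 * (B / (2 * L))"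
      by (intro add_mono mult_right_mono e1 e2) (use B0 L in auto)
    finally show ?thesis by simp
  qed
  have mem: "H G \<in> bcontfun" for G
    by (rule bcontfun_normI[OF contH normH])
  define \<H> where "\<H> G = Bcontfun (H G)" for G
  have app: "apply_bcontfun (\<H> G) = H G" for G
    unfolding \<H>_def by (rule Bcontfun_inverse[OF mem])
  have contr: "dist (\<H> G1) (\<H> G2) \<le> (1/2) * dist G1 G2" for G1 G2
  proof (rule dist_bound)
    fix t
    let ?d = "dist G1 G2"
    have kd: "norm (k G1 s - k G2 s) \<le> L * exp (2 * L * s) * ?d" for s
    proof -
      have "norm (k G1 s - k G2 s) \<le> L * norm (exp (2 * L * s) *\<^sub>R G1 s - exp (2 * L * s) *\<^sub>R G2 s)"
        using lipschitz_onD[OF lip] unfolding k_def by (simp add: dist_norm)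
      also have "\<dots> = L * (exp (2 * L * s) * dist (G1 s) (G2 s))"
        by (simp add: scaleR_diff_right[symmetric] dist_norm)
      also have "\<dots> \<le> L * (exp (2 * L * s) * ?d)"
        using L dist_bounded[of G1 s G2] by simp
      finally show ?thesis by simp
    qed
    \<comment> \<open>Integrating the weight divides by \<open>2 * L\<close>, against the Lipschitz
      factor \<open>L\<close>: this is the source of the contraction factor 1/2.\<close>
    have I: "((\<lambda>s. L * exp (2 * L * s) * ?d) has_integral
        (exp (2 * L * p t) / 2 * ?d - exp (2 * L * 0) / 2 * ?d)) {0..p t}"
      by (rule fundamental_theorem_of_calculus)
         (auto simp: p0 has_real_derivative_iff_has_vector_derivative[symmetric]
            intro!: derivative_eq_intros)
    have "norm (integral {0..p t} (\<lambda>s. k G1 s - k G2 s)) \<le> integral {0..p t} (\<lambda>s. L * exp (2 * L * s) * ?d)"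
      by (rule integral_norm_bound_integral) (use kd I intk in \<open>auto intro!: integrable_diff\<close>)
    also have "\<dots> \<le> exp (2 * L * p t) / 2 * ?d"
      using integral_unique[OF I] by simp
    finally have "norm (integral {0..p t} (k G1) - integral {0..p t} (k G2)) \<le> exp (2 * L * p t) / 2 * ?d"
      by (simp add: integral_diff intk)
    then have "dist (H G1 t) (H G2 t) \<le> exp (- 2 * L * p t) * (exp (2 * L * p t) / 2 * ?d)"
      unfolding H_def dist_norm scaleR_diff_right[symmetric] by simp
    also have "\<dots> = (1/2) * ?d" by (simp add: exp_minus field_simps)
    finally show "dist (apply_bcontfun (\<H> G1) t) (apply_bcontfun (\<H> G2) t) \<le> (1/2) * ?d"
      by (simp add: app)
  qed
  then obtain G where G: "\<H> G = G"
    using banach_fix_type[of "1/2" \<H>] by auto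
  define \<phi> where "\<phi> t = x + integral {0..t} (k G)" for t
  have kphi: "k G t = F (\<phi> t)" if "t \<ge> 0" for t
  proof -
    have "apply_bcontfun G t = exp (- 2 * L * t) *\<^sub>R \<phi> t"
      using app[of G] that unfolding G H_def \<phi>_def by (simp add: p_def)
    then show ?thesis by (simp add: k_def exp_minus)
  qed
  have "(\<phi> has_vector_derivative F (\<phi> t)) (at t within {0..})" if "t \<ge> 0" for t
    unfolding kphi[OF that, symmetric] unfolding \<phi>_def
    using has_vector_derivative_add[OF has_vector_derivative_const deriv[OF that]] by simp
  then show ?thesis
    by (auto simp: ode_solution_def \<phi>_def intro!: exI[of _ \<phi>])
qed

text \<open>Negative times come from the forward solution for \<open>- F\<close> run backwards. The
  halves can be glued because at time 0 both one-sided derivatives equal \<open>F x\<close>.\<close>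

lemma lipschitz_bounded_ode:
  fixes F :: "'a::euclidean_space \<Rightarrow> 'a"
  assumes L: "L > 0" and lip: "L-lipschitz_on UNIV F" and B: "\<And>x. norm (F x) \<le> B"
  shows "\<exists>\<phi>. ode_solution F UNIV \<phi> x"
proof -
  have lip': "L-lipschitz_on UNIV (\<lambda>x. - F x)"
    using lip by (simp add: lipschitz_on_def dist_minus)
  obtain \<psi> where \<psi>: "\<psi> 0 = x" "\<And>t. t \<ge> 0 \<Longrightarrow> (\<psi> has_vector_derivative F (\<psi> t)) (at t within {0..})"
    using lipschitz_bounded_ode_forward[OF L lip B, of x] by (auto simp: ode_solution_def)
  have B': "norm (- F x) \<le> B" for x using B by simp
  obtain \<eta> where \<eta>: "\<eta> 0 = x" "\<And>t. t \<ge> 0 \<Longrightarrow> (\<eta> has_vector_derivative (- F (\<eta> t))) (at t within {0..})"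
    using lipschitz_bounded_ode_forward[OF L lip' B', of x] by (auto simp: ode_solution_def)
  have \<eta>': "((\<lambda>t. \<eta> (- t)) has_vector_derivative F (\<eta> (- t))) (at t within {..0})" if "t \<le> 0" for t
  proof -
    have "(\<eta> has_vector_derivative (- F (\<eta> (- t)))) (at (- t) within (uminus ` {..0}))"
      using \<eta>(2)[of "- t"] that by simp
    moreover have "(uminus has_vector_derivative -1) (at t within {..0})"
      by (auto intro!: derivative_eq_intros)
    ultimately show ?thesis
      using vector_diff_chain_within[of uminus "-1" t "{..0}" \<eta> "- F (\<eta> (- t))"] by (simp add: o_def)
  qed
  define \<phi> where "\<phi> t = (if t \<in> {0..} then \<psi> t else \<eta> (- t))" for t
  have "(\<phi> has_vector_derivative (if t \<in> {0..} then F (\<psi> t) else F (\<eta> (- t)))) (at t within UNIV)" for t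
    unfolding \<phi>_def
  proof (rule has_vector_derivative_If_within_closures[where T = "{..<0}"])
    have s: "{0..} \<union> closure {0..} \<inter> closure {..<0} = {0::real..}"
      "{..<0} \<union> closure {0..} \<inter> closure {..<0} = {..0::real}" by auto
    show "(\<psi> has_vector_derivative F (\<psi> t)) (at t within {0..} \<union> closure {0..} \<inter> closure {..<0})"
      if "t \<in> {0..} \<union> closure {0..} \<inter> closure {..<0}"
      using that unfolding s by (auto intro: \<psi>)
    show "((\<lambda>t. \<eta> (- t)) has_vector_derivative F (\<eta> (- t))) (at t within {..<0} \<union> closure {0..} \<inter> closure {..<0})"
      if "t \<in> {..<0} \<union> closure {0..} \<inter> closure {..<0}"
      using that unfolding s by (auto intro: \<eta>')
  qed (auto simp: \<psi> \<eta>)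
  then have "(\<phi> has_vector_derivative F (\<phi> t)) (at t)" for t
    by (smt (verit, ccfv_SIG) \<phi>_def)
  then show ?thesis
    using \<psi>(1) by (auto simp: ode_solution_def \<phi>_def intro!: exI[of _ \<phi>])
qed

text \<open>By Cauchy-Schwarz the squared distance of two solutions grows at rate at most
  \<open>2 * L\<close>. Multiplied by \<open>exp (- 2 * L * t)\<close> it is nonincreasing, and it
  vanishes at time \<open>s\<close>.\<close>

lemma lipschitz_ode_unique_forward:
  fixes F :: "'a::euclidean_space \<Rightarrow> 'a"
  assumes lip: "L-lipschitz_on UNIV F"
    and d1: "\<And>t. (\<phi> has_vector_derivative F (\<phi> t)) (at t)"
    and d2: "\<And>t. (\<psi> has_vector_derivative F (\<psi> t)) (at t)"
    and eq: "\<phi> s = \<psi> s" and "s \<le> t"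
  shows "\<phi> t = \<psi> t"
proof -
  define D where "D t = exp (- 2 * L * t) * ((\<phi> t - \<psi> t) \<bullet> (\<phi> t - \<psi> t))" for t
  let ?D' = "\<lambda>t. exp (- 2 * L * t) *
     (2 * ((\<phi> t - \<psi> t) \<bullet> (F (\<phi> t) - F (\<psi> t))) - 2 * L * ((\<phi> t - \<psi> t) \<bullet> (\<phi> t - \<psi> t)))"
  have d: "(\<phi> has_derivative (\<lambda>h. h *\<^sub>R F (\<phi> t))) (at t)" "(\<psi> has_derivative (\<lambda>h. h *\<^sub>R F (\<psi> t))) (at t)" for t
    using d1 d2 by (auto simp: has_vector_derivative_def)
  have "(D has_field_derivative ?D' t) (at t)" for t
    unfolding D_def has_field_derivative_def
    by (rule derivative_eq_intros d refl)+
       (auto simp: fun_eq_iff algebra_simps inner_commute)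
  moreover have "?D' t \<le> 0" for t
  proof -
    have "(\<phi> t - \<psi> t) \<bullet> (F (\<phi> t) - F (\<psi> t)) \<le> norm (\<phi> t - \<psi> t) * norm (F (\<phi> t) - F (\<psi> t))"
      by (rule norm_cauchy_schwarz)
    also have "\<dots> \<le> norm (\<phi> t - \<psi> t) * (L * norm (\<phi> t - \<psi> t))"
      using lipschitz_onD[OF lip, of "\<phi> t" "\<psi> t"] by (intro mult_left_mono) (auto simp: dist_norm)
    also have "\<dots> = L * ((\<phi> t - \<psi> t) \<bullet> (\<phi> t - \<psi> t))"
      by (simp add: dot_square_norm power2_eq_square)
    finally show ?thesis by (auto simp: mult_le_0_iff)
  qed
  ultimately have "D t \<le> D s"
    using DERIV_nonpos_imp_nonincreasing[OF \<open>s \<le> t\<close>, of D] by blast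
  also have "D s = 0" by (simp add: D_def eq)
  finally have "D t \<le> 0" .
  moreover have "exp (- 2 * L * t) > 0" by simp
  ultimately have "(\<phi> t - \<psi> t) \<bullet> (\<phi> t - \<psi> t) \<le> 0"
    unfolding D_def by (meson mult_pos_pos not_less)
  then have "(\<phi> t - \<psi> t) \<bullet> (\<phi> t - \<psi> t) = 0" using inner_ge_zero by (rule antisym)
  then show ?thesis by simp
qed

lemma lipschitz_ode_unique:
  fixes F :: "'a::euclidean_space \<Rightarrow> 'a"
  assumes lip: "L-lipschitz_on UNIV F"
    and d1: "\<And>t. (\<phi> has_vector_derivative F (\<phi> t)) (at t)"
    and d2: "\<And>t. (\<psi> has_vector_derivative F (\<psi> t)) (at t)"
    and eq: "\<phi> s = \<psi> s"
  shows "\<phi> t = \<psi> t"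
proof (cases "s \<le> t")
  case True
  then show ?thesis using lipschitz_ode_unique_forward[OF lip d1 d2 eq] by blast
next
  case False
  have lip': "L-lipschitz_on UNIV (\<lambda>x. - F x)"
    using lip by (simp add: lipschitz_on_def dist_minus)
  have rev: "((\<lambda>t. \<xi> (- t)) has_vector_derivative (- F (\<xi> (- t)))) (at t)"
    if "\<And>t. (\<xi> has_vector_derivative F (\<xi> t)) (at t)" for \<xi> t
  proof -
    have "(uminus has_vector_derivative -1) (at t)" by (auto intro!: derivative_eq_intros)
    from vector_diff_chain_at[OF this that] show ?thesis by (simp add: o_def)
  qed
  show ?thesis
    using lipschitz_ode_unique_forward[OF lip' rev[OF d1] rev[OF d2], of "- s" "- t"] False eq by simp
qed

text \<open>Local error of one Euler step: the speed bound keeps the trajectory within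
  \<open>B * s\<close> of its start, so its velocity changes by at most \<open>L * B * s\<close>
  during the step.\<close>

lemma ode_second_order_estimate:
  fixes F :: "'a::euclidean_space \<Rightarrow> 'a"
  assumes lip: "L-lipschitz_on UNIV F" and B: "\<And>x. norm (F x) \<le> B"
    and d: "\<And>t. (\<phi> has_vector_derivative F (\<phi> t)) (at t)"
    and s: "s \<ge> 0"
  shows "norm (\<phi> (t + s) - \<phi> t) \<le> B * s"
    and "norm (\<phi> (t + s) - \<phi> t - s *\<^sub>R F (\<phi> t)) \<le> L * B * s\<^sup>2"
proof -
  have 1: "norm (\<phi> (t + r) - \<phi> t) \<le> B * r" if "r \<ge> 0" for r
  proof -
    have "norm (\<phi> (t + r) - \<phi> t) \<le> B * norm (t + r - t)"
    proof (rule differentiable_bound[of UNIV \<phi> "\<lambda>t h. h *\<^sub>R F (\<phi> t)"])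
      show "onorm (\<lambda>h. h *\<^sub>R F (\<phi> u)) \<le> B" for u
      proof (rule onorm_le)
        show "norm (h *\<^sub>R F (\<phi> u)) \<le> B * norm h" for h :: real
          using mult_left_mono[OF B[of "\<phi> u"] norm_ge_zero[of h]] by (simp add: mult.commute[of B])
      qed
      show "(\<phi> has_derivative (\<lambda>h. h *\<^sub>R F (\<phi> u))) (at u)" for u
        using d[of u] by (simp add: has_vector_derivative_def)
    qed auto
    then show ?thesis using that by simp
  qed
  show "norm (\<phi> (t + s) - \<phi> t) \<le> B * s" by (rule 1[OF s])
  have L: "L \<ge> 0" using lip by (rule lipschitz_on_nonneg)
  have B0: "B \<ge> 0" using B[of 0] norm_ge_zero[of "F 0"] by linarith
  have "norm (\<phi> (t + s) - \<phi> t - (t + s - t) *\<^sub>R F (\<phi> t)) \<le> norm (t + s - t) * (L * B * s)"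
  proof (rule vector_differentiable_bound_linearization)
    show "(\<phi> has_vector_derivative F (\<phi> x)) (at x within {t..t + s})" for x
      using d by (rule has_vector_derivative_at_within)
    show "closed_segment t (t + s) \<subseteq> {t..t + s}" "t \<in> {t..t + s}" using s by (auto simp: closed_segment_eq_real_ivl)
    fix x assume x: "x \<in> {t..t + s}"
    have "norm (F (\<phi> x) - F (\<phi> t)) \<le> L * norm (\<phi> x - \<phi> t)"
      using lipschitz_onD[OF lip, of "\<phi> x" "\<phi> t"] by (auto simp: dist_norm)
    also have "\<dots> \<le> L * (B * s)"
    proof (rule mult_left_mono[OF _ L])
      have "norm (\<phi> x - \<phi> t) \<le> B * (x - t)" using 1[of "x - t"] x by simp
      also have "\<dots> \<le> B * s" using x B0 by (intro mult_left_mono) auto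
      finally show "norm (\<phi> x - \<phi> t) \<le> B * s" .
    qed
    finally show "norm (F (\<phi> x) - F (\<phi> t)) \<le> L * B * s" by simp
  qed
  then show "norm (\<phi> (t + s) - \<phi> t - s *\<^sub>R F (\<phi> t)) \<le> L * B * s\<^sup>2"
    using s by (simp add: power2_eq_square mult_ac)
qed

section \<open>Perturbed Euler schemes\<close>

text \<open>Substituting the bound into the recursion leaves the inequality \<open>geo\<close>,
  which gains one factor \<open>1 + c k \<le> exp (c k)\<close> at a time.\<close>

lemma discrete_gronwall:
  fixes e c :: "nat \<Rightarrow> real"
  assumes c: "\<And>i. c i \<ge> 0" and \<delta>: "\<delta> \<ge> 0"
    and e: "\<And>k. k \<le> K \<Longrightarrow> e k \<le> \<delta> + (\<Sum>i<k. c i * e i)"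
  shows "k \<le> K \<Longrightarrow> e k \<le> \<delta> * exp (\<Sum>i<k. c i)"
proof (induction k rule: less_induct)
  case (less k)
  have geo: "1 + (\<Sum>i<k. c i * exp (\<Sum>j<i. c j)) \<le> exp (\<Sum>i<k. c i)" for k
  proof (induction k)
    case (Suc k)
    have "1 + (\<Sum>i<Suc k. c i * exp (\<Sum>j<i. c j)) \<le> (1 + c k) * exp (\<Sum>i<k. c i)"
      using Suc by (simp add: algebra_simps)
    also have "\<dots> \<le> exp (c k) * exp (\<Sum>i<k. c i)"
      by (intro mult_right_mono exp_ge_add_one_self) auto
    finally show ?case by (simp add: exp_add mult.commute)
  qed simp
  have "e k \<le> \<delta> + (\<Sum>i<k. c i * e i)" using e less.prems .
  also have "\<dots> \<le> \<delta> + (\<Sum>i<k. c i * (\<delta> * exp (\<Sum>j<i. c j)))"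
    using less by (intro add_left_mono sum_mono mult_left_mono c) auto
  also have "\<dots> = \<delta> * (1 + (\<Sum>i<k. c i * exp (\<Sum>j<i. c j)))"
    by (simp add: algebra_simps sum_distrib_left)
  also have "\<dots> \<le> \<delta> * exp (\<Sum>i<k. c i)" by (intro mult_left_mono geo \<delta>)
  finally show ?case .
qed

text \<open>The error recursion is summed before norms are taken. Thus the noise enters through its
  partial sums only and may cancel, while the drift differences feed the Gronwall bound and the
  local Euler errors add up to at most \<open>\<eta>\<close>.\<close>

lemma perturbed_euler_estimate:
  fixes F :: "'a::euclidean_space \<Rightarrow> 'a"
  assumes lip: "L-lipschitz_on UNIV F" and B: "\<And>x. norm (F x) \<le> B"
    and d: "\<And>t. (\<phi> has_vector_derivative F (\<phi> t)) (at t)"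
    and al: "\<And>i. al i \<ge> 0"
    and x: "\<And>i. x (Suc i) = x i + al i *\<^sub>R F (x i) + u i"
    and u: "\<And>k. k \<le> K \<Longrightarrow> norm (\<Sum>i<k. u i) \<le> \<delta>"
    and q: "L * B * (\<Sum>i<K. (al i)\<^sup>2) \<le> \<eta>"
    and k: "k \<le> K"
  shows "norm (x k - \<phi> (\<Sum>i<k. al i)) \<le> (norm (x 0 - \<phi> 0) + \<delta> + \<eta>) * exp (L * (\<Sum>i<k. al i))"
proof -
  have L: "L \<ge> 0" using lip by (rule lipschitz_on_nonneg)
  have B0: "B \<ge> 0" using B[of 0] norm_ge_zero[of "F 0"] by linarith
  define s where "s k = (\<Sum>i<k. al i)" for k
  define r where "r i = \<phi> (s i + al i) - \<phi> (s i) - al i *\<^sub>R F (\<phi> (s i))" for i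
  have r: "norm (r i) \<le> L * B * (al i)\<^sup>2" for i
    unfolding r_def by (rule ode_second_order_estimate[OF lip B d al])
  have eq: "x k - \<phi> (s k) = x 0 - \<phi> 0 + (\<Sum>i<k. al i *\<^sub>R (F (x i) - F (\<phi> (s i)))) + (\<Sum>i<k. u i) - (\<Sum>i<k. r i)" for k
  proof (induction k)
    case (Suc k)
    have "\<phi> (s (Suc k)) = \<phi> (s k) + al k *\<^sub>R F (\<phi> (s k)) + r k"
      by (simp add: r_def s_def add.commute)
    then show ?case using Suc by (simp add: x algebra_simps)
  qed (simp add: s_def)
  have "norm (x k - \<phi> (s k)) \<le> (norm (x 0 - \<phi> 0) + \<delta> + \<eta>) + (\<Sum>i<k. (L * al i) * norm (x i - \<phi> (s i)))"
    if "k \<le> K" for k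
  proof -
    have "norm (\<Sum>i<k. al i *\<^sub>R (F (x i) - F (\<phi> (s i)))) \<le> (\<Sum>i<k. (L * al i) * norm (x i - \<phi> (s i)))"
    proof (rule sum_norm_le)
      fix i
      have "norm (al i *\<^sub>R (F (x i) - F (\<phi> (s i)))) \<le> al i * (L * norm (x i - \<phi> (s i)))"
        using lipschitz_onD[OF lip, of "x i" "\<phi> (s i)"] al[of i]
        by (simp add: dist_norm mult_left_mono)
      then show "norm (al i *\<^sub>R (F (x i) - F (\<phi> (s i)))) \<le> L * al i * norm (x i - \<phi> (s i))"
        by (simp add: mult_ac)
    qed
    moreover have "norm (\<Sum>i<k. r i) \<le> \<eta>"
    proof -
      have "norm (\<Sum>i<k. r i) \<le> (\<Sum>i<k. L * B * (al i)\<^sup>2)"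
        by (rule sum_norm_le) (rule r)
      also have "\<dots> \<le> (\<Sum>i<K. L * B * (al i)\<^sup>2)"
        using L B0 that by (intro sum_mono2) auto
      finally show ?thesis using q by (simp add: sum_distrib_left)
    qed
    ultimately show ?thesis
      unfolding eq[of k] using u[OF that]
      by (smt (verit) norm_triangle_ineq norm_triangle_ineq4)
  qed
  then have "norm (x k - \<phi> (s k)) \<le> (norm (x 0 - \<phi> 0) + \<delta> + \<eta>) * exp (\<Sum>i<k. L * al i)"
  proof (rule discrete_gronwall[rotated 2])
    show "0 \<le> norm (x 0 - \<phi> 0) + \<delta> + \<eta>"
    proof -
      have "0 \<le> \<delta>" using u[of 0] by simp
      moreover have "0 \<le> L * B * (\<Sum>i<K. (al i)\<^sup>2)" using L B0 by (simp add: sum_nonneg)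
      ultimately show ?thesis using q by (smt (verit) norm_ge_zero)
    qed
  qed (use k L al in auto)
  then show ?thesis by (simp add: s_def sum_distrib_left)
qed

text \<open>\<open>\<delta>\<close> and \<open>n0\<close> are fixed before the solution and the
  window are chosen. This uniformity lets one estimate serve all points of the limit set and all
  links of a chain.\<close>

lemma asymptotic_pseudotrajectory:
  fixes F :: "'a::euclidean_space \<Rightarrow> 'a"
  assumes lip: "L-lipschitz_on UNIV F" and B: "\<And>x. norm (F x) \<le> B"
    and al: "\<And>i. al i \<ge> 0" "summable (\<lambda>i. (al i)\<^sup>2)"
    and y: "\<And>i. y (Suc i) = y i + al i *\<^sub>R F (y i) + u i" and u: "summable u"
    and \<epsilon>: "\<epsilon> > 0"
  obtains \<delta> n0 where "\<delta> > 0"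
    "\<And>\<phi> n k. (\<And>t. (\<phi> has_vector_derivative F (\<phi> t)) (at t)) \<Longrightarrow> n \<ge> n0 \<Longrightarrow> k \<ge> n \<Longrightarrow>
       dist (\<phi> 0) (y n) < \<delta> \<Longrightarrow> sum al {n..<k} \<le> T \<Longrightarrow> dist (\<phi> (sum al {n..<k})) (y k) < \<epsilon>"
proof -
  have L: "L \<ge> 0" using lip by (rule lipschitz_on_nonneg)
  have B0: "B \<ge> 0" using B[of 0] norm_ge_zero[of "F 0"] by linarith
  \<comment> \<open>Initial distance, accumulated noise and Euler errors each get a third of
    \<open>\<epsilon>\<close>, reduced by the Gronwall factor for a window of length
    \<open>T\<close>.\<close>
  define \<delta> where "\<delta> = \<epsilon> * exp (- L * T) / 3"
  have \<delta>: "\<delta> > 0" using \<epsilon> by (simp add: \<delta>_def)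
  obtain n1 where n1: "\<And>n k. n \<ge> n1 \<Longrightarrow> norm (sum u {n..<k}) < \<delta>"
    using u \<delta> unfolding summable_Cauchy by blast
  \<comment> \<open>The \<open>+ 1\<close> in the divisor covers the case that \<open>L * B\<close>
    vanishes.\<close>
  obtain n2 where n2: "\<And>n k. n \<ge> n2 \<Longrightarrow> norm (\<Sum>i\<in>{n..<k}. (al i)\<^sup>2) < \<delta> / (L * B + 1)"
    using al(2) \<delta> L B0 unfolding summable_Cauchy
    by (metis add_nonneg_pos divide_pos_pos mult_nonneg_nonneg zero_less_one)
  have shift: "sum f {n..<n + k} = (\<Sum>i<k. f (n + i))" for f :: "nat \<Rightarrow> 'b::comm_monoid_add" and n k
    by (rule sum.reindex_bij_witness[of _ "\<lambda>i. n + i" "\<lambda>i. i - n"]) auto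
  show thesis
  proof (rule that[of \<delta> "max n1 n2"])
    fix \<phi> n k
    assume d: "\<And>t. (\<phi> has_vector_derivative F (\<phi> t)) (at t)" and n: "n \<ge> max n1 n2" and k: "k \<ge> n"
      and init: "dist (\<phi> 0) (y n) < \<delta>" and T: "sum al {n..<k} \<le> T"
    define K where "K = k - n"
    have kK: "k = n + K" using k by (simp add: K_def)
    have "L * B * (\<Sum>i<K. (al (n + i))\<^sup>2) \<le> (L * B + 1) * (\<delta> / (L * B + 1))"
      using n2[of n "n + K"] n L B0 unfolding shift by (intro mult_mono) (auto simp: sum_nonneg)
    moreover have "L * B + 1 > 0" using L B0 by (simp add: add_nonneg_pos)
    ultimately have q: "L * B * (\<Sum>i<K. (al (n + i))\<^sup>2) \<le> \<delta>" by simp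
    have "norm (y (n + K) - \<phi> (\<Sum>i<K. al (n + i))) \<le>
        (norm (y (n + 0) - \<phi> 0) + \<delta> + \<delta>) * exp (L * (\<Sum>i<K. al (n + i)))"
      by (rule perturbed_euler_estimate[where u = "\<lambda>i. u (n + i)", OF lip B d _ _ _ q])
         (use al y n1[of n "n + _"] n in \<open>auto simp: shift less_imp_le\<close>)
    also have "\<dots> \<le> (norm (y (n + 0) - \<phi> 0) + \<delta> + \<delta>) * exp (L * T)"
      using T L \<delta> by (intro mult_left_mono) (auto simp: kK shift mult_left_mono)
    also have "\<dots> < (\<delta> + \<delta> + \<delta>) * exp (L * T)"
      using init by (intro mult_strict_right_mono) (auto simp: dist_norm norm_minus_commute)
    also have "\<dots> = \<epsilon>" by (simp add: \<delta>_def exp_minus)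
    finally show "dist (\<phi> (sum al {n..<k})) (y k) < \<epsilon>"
      by (simp add: kK shift dist_norm norm_minus_commute)
  qed (rule \<delta>)
qed

text \<open>The least index at which the elapsed time reaches \<open>T\<close> overshoots by at most
  one step, because its predecessor was still short of \<open>T\<close>.\<close>

lemma sum_at_top_window:
  fixes al :: "nat \<Rightarrow> real"
  assumes al: "\<And>i. al i \<ge> 0" "filterlim (\<lambda>n. \<Sum>k<n. al k) at_top sequentially"
    and small: "\<And>i. i \<ge> n \<Longrightarrow> al i < \<eta>" and T: "T \<ge> 0"
  obtains k where "k \<ge> n" "T \<le> sum al {n..<k}" "sum al {n..<k} \<le> T + \<eta>"
proof -
  have split: "(\<Sum>i<k. al i) = (\<Sum>i<n. al i) + sum al {n..<k}" if "k \<ge> n" for k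
    using that by (metis lessThan_atLeast0 sum.atLeastLessThan_concat zero_le)
  have "\<exists>k\<ge>n. (\<Sum>i<k. al i) \<ge> T + (\<Sum>i<n. al i)"
    using al(2) unfolding filterlim_at_top eventually_sequentially by (meson nle_le)
  then have ex: "\<exists>k. k \<ge> n \<and> T \<le> sum al {n..<k}"
    using split by (metis add.commute add_le_cancel_right)
  define k where "k = (LEAST k. k \<ge> n \<and> T \<le> sum al {n..<k})"
  have k: "k \<ge> n" "T \<le> sum al {n..<k}"
    using LeastI_ex[OF ex] by (auto simp: k_def)
  have \<eta>: "\<eta> > 0" using small[of n] al(1)[of n] by simp
  have "sum al {n..<k} \<le> T + \<eta>"
  proof (cases "k = n")
    case True
    then show ?thesis using T \<eta> by simp
  next
    case False
    then obtain k' where k': "k = Suc k'" "k' \<ge> n" using k(1) by (cases k) auto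
    then have "\<not> T \<le> sum al {n..<k'}"
      using not_less_Least[of k' "\<lambda>k. k \<ge> n \<and> T \<le> sum al {n..<k}"] by (auto simp: k_def[symmetric])
    then show ?thesis using small[OF k'(2)] k' by simp
  qed
  then show thesis using that k by blast
qed

text \<open>Counterpart with prescribed end: take the greatest start that leaves time
  \<open>T\<close>. As the time from \<open>N\<close> to \<open>n\<close> already reaches
  \<open>T\<close>, this start lies in the region of small steps.\<close>

lemma sum_at_top_window_before:
  fixes al :: "nat \<Rightarrow> real"
  assumes al: "\<And>i. al i \<ge> 0" and small: "\<And>i. i \<ge> N \<Longrightarrow> al i < \<eta>" and T: "T > 0"
    and n: "T \<le> sum al {N..<n}"
  obtains k where "k \<ge> N" "k \<le> n" "T \<le> sum al {k..<n}" "sum al {k..<n} \<le> T + \<eta>"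
proof -
  define k where "k = (GREATEST k. T \<le> sum al {k..<n})"
  have bd: "k \<le> n" if "T \<le> sum al {k..<n}" for k
    using that T by (cases "k \<le> n") auto
  have k: "T \<le> sum al {k..<n}"
    unfolding k_def by (rule GreatestI_nat[where P = "\<lambda>k. T \<le> sum al {k..<n}", OF n bd])
  have kN: "k \<ge> N" unfolding k_def
    by (rule Greatest_le_nat[where P = "\<lambda>k. T \<le> sum al {k..<n}", OF n bd])
  have kn: "k < n" using k T by (cases "k < n") auto
  have "\<not> T \<le> sum al {Suc k..<n}"
    using Greatest_le_nat[where P = "\<lambda>k. T \<le> sum al {k..<n}", OF _ bd, of "Suc k"] by (auto simp: k_def[symmetric])
  then have "sum al {k..<n} \<le> T + \<eta>"
    using small[OF kN] kn by (simp add: sum.atLeast_Suc_lessThan)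
  then show thesis using that k kN kn by auto
qed

text \<open>Shadowing turns a late visit near a point into a later visit near its image under the
  flow; this drives both invariance and chaining. Invariance in turn keeps the trajectories of limit
  points where the truncated field agrees with \<open>h\<close>, so the truncation disappears from
  the result.\<close>

theorem perturbed_euler_limit_set:
  fixes h :: "'a::euclidean_space \<Rightarrow> 'a"
  assumes loc: "local_lipschitz (UNIV :: real set) UNIV (\<lambda>_. h)"
    and al_pos: "\<And>i. al i > 0" and al_sum: "filterlim (\<lambda>n. \<Sum>k<n. al k) at_top sequentially"
    and al_sq: "summable (\<lambda>i. (al i)\<^sup>2)"
    and y: "\<And>i. y (Suc i) = y i + al i *\<^sub>R h (y i) + u i" and u: "summable u"
    and bdd: "bounded (range y)"
  shows "\<exists>A. internally_chain_transitive h A \<and> (\<lambda>n. infdist (y n) A) \<longlonglongrightarrow> 0"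
proof -
  obtain R where R: "R > 0" "\<And>n. norm (y n) \<le> R" using bdd by (auto simp: bounded_pos)
  define C where "C = cball (0::'a) R"
  have C: "convex C" "closed C" "C \<noteq> {}" "compact C" using R(1) by (auto simp: C_def)
  have yC: "y n \<in> C" for n using R by (simp add: C_def)
  \<comment> \<open>The truncation agrees with \<open>h\<close> on the ball \<open>C\<close>, which will contain every trajectory that matters.\<close>
  define F where "F x = h (closest_point C x)" for x
  have Fh: "F x = h x" if "x \<in> C" for x using that by (simp add: F_def closest_point_self)
  have "local_lipschitz {0::real} C (\<lambda>_. h)" by (rule local_lipschitz_subset[OF loc]) auto
  then obtain L0 where L0: "L0-lipschitz_on C h"
    using local_lipschitz_compact_implies_lipschitz[OF _ C(4), of "{0}" "\<lambda>_. h"] by auto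
  \<comment> \<open>Existence of solutions was proved for a strictly positive Lipschitz
    constant.\<close>
  define L where "L = L0 + 1"
  have L: "L > 0" using lipschitz_on_nonneg[OF L0] by (simp add: L_def)
  have lip: "L-lipschitz_on UNIV F"
  proof (rule lipschitz_onI)
    fix x z
    have "dist (F x) (F z) \<le> L0 * dist (closest_point C x) (closest_point C z)"
      unfolding F_def using C by (intro lipschitz_onD[OF L0] closest_point_in_set)
    also have "\<dots> \<le> L * dist x z"
      unfolding L_def using lipschitz_on_nonneg[OF L0] closest_point_lipschitz[OF C(1-3), of x z]
      by (intro mult_mono) auto
    finally show "dist (F x) (F z) \<le> L * dist x z" .
  qed (use L in simp)
  have "compact (h ` C)"
    using L0 C(4) by (intro compact_continuous_image) (auto intro: lipschitz_on_continuous_on)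
  then obtain B where B0: "B > 0" and "\<And>x. x \<in> C \<Longrightarrow> norm (h x) \<le> B"
    using compact_imp_bounded bounded_pos by (metis imageI)
  then have B: "norm (F x) \<le> B" for x
    unfolding F_def using closest_point_in_set[OF C(2,3)] by blast
  obtain \<Phi> where \<Phi>: "\<And>x. ode_solution F UNIV (\<Phi> x) x"
    using lipschitz_bounded_ode[OF L lip B] by metis
  have \<Phi>0: "\<Phi> x 0 = x" and \<Phi>d: "(\<Phi> x has_vector_derivative F (\<Phi> x t)) (at t)" for x t
    using \<Phi> by (auto simp: ode_solution_def)
  have \<Phi>c: "dist (\<Phi> x t) (\<Phi> x s) \<le> B * (s - t)" if "s \<ge> t" for x s t
    using ode_second_order_estimate(1)[OF lip B \<Phi>d, of "s - t" x t] that
    by (simp add: dist_norm norm_minus_commute)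
  have al_ge: "al i \<ge> 0" for i using al_pos less_imp_le by blast
  have yF: "y (Suc i) = y i + al i *\<^sub>R F (y i) + u i" for i by (simp add: y Fh yC)
  note shadow = asymptotic_pseudotrajectory[OF lip B al_ge al_sq yF u]
  have "(\<lambda>i. sqrt ((al i)\<^sup>2)) \<longlonglongrightarrow> sqrt 0"
    by (intro tendsto_real_sqrt summable_LIMSEQ_zero al_sq)
  then have "al \<longlonglongrightarrow> 0" using al_ge by simp
  then have small: "\<exists>N. \<forall>i\<ge>N. al i < \<eta>" if "\<eta> > 0" for \<eta>
    using that by (auto dest!: order_tendstoD(2)[where a = \<eta>] simp: eventually_sequentially)

  define A where "A = {x. \<forall>e>0. \<forall>N. \<exists>n\<ge>N. dist (y n) x < e}"
  have AD: "\<exists>n\<ge>N. dist (y n) x < e" if "x \<in> A" "e > 0" for x e N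
    using that unfolding A_def by blast
  \<comment> \<open>The condition on \<open>r\<close> makes every subsequence run through late
    indices. It is applied to all indices (nonemptiness), to indices far from \<open>A\<close>
    (convergence) and to the starts of backward windows (invariance).\<close>
  have cluster: "\<exists>x\<in>A. \<exists>s. strict_mono s \<and> (\<lambda>k. y (r (s k))) \<longlonglongrightarrow> x" if r: "\<And>k. r k \<ge> k" for r :: "nat \<Rightarrow> nat"
  proof -
    obtain x s where s: "strict_mono (s :: nat \<Rightarrow> nat)" "((\<lambda>k. y (r k)) \<circ> s) \<longlonglongrightarrow> x"
      using seq_compactE[OF compact_imp_seq_compact[OF C(4)], of "\<lambda>k. y (r k)"] yC by metis
    have "\<exists>n\<ge>N. dist (y n) x < e" if e: "e > 0" for e N
    proof -
      obtain K where K: "\<And>k. k \<ge> K \<Longrightarrow> dist (y (r (s k))) x < e"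
        using s(2) e unfolding lim_sequentially by auto
      have "r (s (max K N)) \<ge> N"
        using r[of "s (max K N)"] seq_suble[OF s(1), of "max K N"] by linarith
      then show ?thesis using K[of "max K N"] by auto
    qed
    then show ?thesis using s by (auto simp: A_def o_def)
  qed
  have Ane: "A \<noteq> {}" using cluster[of id] by auto
  have AC: "A \<subseteq> C"
  proof
    fix x assume x: "x \<in> A"
    have "\<exists>z\<in>C. dist z x < e" if "e > 0" for e
    proof -
      show ?thesis using AD[OF x that] yC by blast
    qed
    then show "x \<in> C" using closed_approachable[OF C(2)] by blast
  qed
  have Acl: "closed A"
  proof -
    have "x \<in> A" if x: "\<And>e. e > 0 \<Longrightarrow> \<exists>z\<in>A. dist z x < e" for x
      unfolding A_def
    proof safe
      fix e :: real and N :: nat assume e: "e > 0"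
      obtain z where z: "z \<in> A" "dist z x < e/2" using x[of "e/2"] e by auto
      obtain n where n: "n \<ge> N" "dist (y n) z < e/2" using AD[OF z(1), of "e/2" N] e by auto
      have "dist (y n) x < e" using n z dist_triangle[of "y n" x z] by linarith
      then show "\<exists>n\<ge>N. dist (y n) x < e" using n by blast
    qed
    then show ?thesis
      by (metis closure_approachable closure_subset_eq subsetI)
  qed
  have conv: "(\<lambda>n. infdist (y n) A) \<longlonglongrightarrow> 0"
  proof (rule ccontr)
    assume "\<not> ?thesis"
    then obtain e where e: "e > 0" and "\<forall>N. \<exists>n\<ge>N. \<not> infdist (y n) A < e"
      by (auto simp: lim_sequentially dist_real_def infdist_nonneg)
    then obtain r where r: "\<And>N. r N \<ge> N" "\<And>N. \<not> infdist (y (r N)) A < e" by metis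
    obtain x s where x: "x \<in> A" "(\<lambda>k. y (r (s k))) \<longlonglongrightarrow> x" using cluster[OF r(1)] by blast
    then obtain k where "dist (y (r (s k))) x < e"
      using e unfolding lim_sequentially by blast
    then show False using r(2)[of "s k"] infdist_le[OF x(1), of "y (r (s k))"] by linarith
  qed
  have forward: "\<Phi> x t \<in> A" if x: "x \<in> A" and t: "t \<ge> 0" for x t
    unfolding A_def
  proof safe
    fix e :: real and N :: nat assume e: "e > 0"
    \<comment> \<open>The window may overshoot \<open>t\<close> by \<open>\<eta>\<close>, and
      meanwhile the solution moves at most \<open>B * \<eta> = e / 2\<close>.\<close>
    define \<eta> where "\<eta> = e / (2 * B)"
    have \<eta>: "\<eta> > 0" using e B0 by (simp add: \<eta>_def)
    have e2: "e / 2 > 0" using e by simp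
    obtain \<delta> n0 where \<delta>: "\<delta> > 0" and sh: "\<And>\<phi> n k. (\<And>t. (\<phi> has_vector_derivative F (\<phi> t)) (at t)) \<Longrightarrow> n \<ge> n0 \<Longrightarrow> k \<ge> n \<Longrightarrow>
       dist (\<phi> 0) (y n) < \<delta> \<Longrightarrow> sum al {n..<k} \<le> t + \<eta> \<Longrightarrow> dist (\<phi> (sum al {n..<k})) (y k) < e / 2"
      by (rule shadow[OF e2, of "t + \<eta>"]) blast
    obtain N1 where N1: "\<And>i. i \<ge> N1 \<Longrightarrow> al i < \<eta>" using small[OF \<eta>] by blast
    obtain n where n: "n \<ge> max N (max n0 N1)" "dist (y n) x < \<delta>"
      using AD[OF x \<delta>] by blast
    obtain k where k: "k \<ge> n" "t \<le> sum al {n..<k}" "sum al {n..<k} \<le> t + \<eta>"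
      using sum_at_top_window[OF al_ge al_sum, of n \<eta> t] N1 n(1) t by (metis max.bounded_iff order_trans)
    have "dist (\<Phi> x (sum al {n..<k})) (y k) < e / 2"
      using n k by (intro sh \<Phi>d) (auto simp: \<Phi>0 dist_commute)
    moreover have "dist (\<Phi> x t) (\<Phi> x (sum al {n..<k})) \<le> e / 2"
    proof -
      have "B * (sum al {n..<k} - t) \<le> B * \<eta>" using k B0 by (intro mult_left_mono) auto
      also have "\<dots> = e / 2" using B0 by (simp add: \<eta>_def)
      finally show ?thesis using \<Phi>c[OF k(2), of x] by linarith
    qed
    ultimately have "dist (y k) (\<Phi> x t) < e"
      using dist_triangle[of "y k" "\<Phi> x t" "\<Phi> x (sum al {n..<k})"] by (simp add: dist_commute)
    then show "\<exists>n\<ge>N. dist (y n) (\<Phi> x t) < e" using n(1) k(1) by (intro exI[of _ k]) auto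
  qed
  \<comment> \<open>Start at a cluster point of the positions at time \<open>T\<close> before the visits near \<open>x\<close>.\<close>
  have backward: "\<Phi> x (- T) \<in> A" if x: "x \<in> A" and T: "T > 0" for x T
  proof -
    have "\<exists>k n. k \<ge> j \<and> n \<ge> k \<and> dist (y n) x < 1 / Suc j \<and> T \<le> sum al {k..<n} \<and> sum al {k..<n} \<le> T + 1 / Suc j" for j
    proof -
      obtain N1 where N1: "\<And>i. i \<ge> N1 \<Longrightarrow> al i < 1 / Suc j" using small[of "1 / Suc j"] by auto
      \<comment> \<open>Beyond \<open>N\<close> indices are late and steps small. The visit is then
        sought after a full time \<open>T\<close> has elapsed from \<open>N\<close>, so that the
        backward window fits in.\<close>
      define N where "N = max j N1"
      obtain n1 where n1: "n1 \<ge> N" "T \<le> sum al {N..<n1}"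
        using sum_at_top_window[OF al_ge al_sum, of N "1 / Suc j" T] N1 T by (auto simp: N_def)
      obtain n where n: "n \<ge> n1" "dist (y n) x < 1 / Suc j"
        using AD[OF x, of "1 / Suc j" n1] by auto
      have "T \<le> sum al {N..<n}"
        using n1 n al_ge by (intro order_trans[OF n1(2)] sum_mono2) auto
      from sum_at_top_window_before[OF al_ge _ T this, of "1 / Suc j"] N1
      obtain k where "k \<ge> N" "k \<le> n" "T \<le> sum al {k..<n}" "sum al {k..<n} \<le> T + 1 / Suc j"
        by (auto simp: N_def)
      then show ?thesis using n by (intro exI[of _ k] exI[of _ n]) (auto simp: N_def)
    qed
    then obtain kk nn where kn: "\<And>j. kk j \<ge> j" "\<And>j. nn j \<ge> kk j" "\<And>j. dist (y (nn j)) x < 1 / Suc j"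
      "\<And>j. T \<le> sum al {kk j..<nn j}" "\<And>j. sum al {kk j..<nn j} \<le> T + 1 / Suc j" by metis
    obtain z s where z: "z \<in> A" and s: "strict_mono s" "(\<lambda>j. y (kk (s j))) \<longlonglongrightarrow> z"
      using cluster[OF kn(1)] by blast
    have "dist (\<Phi> z T) x \<le> e" if e: "e > 0" for e
    proof -
      have e3: "e / 3 > 0" using e by simp
      obtain \<delta> n0 where \<delta>: "\<delta> > 0" and sh: "\<And>\<phi> n k. (\<And>t. (\<phi> has_vector_derivative F (\<phi> t)) (at t)) \<Longrightarrow> n \<ge> n0 \<Longrightarrow> k \<ge> n \<Longrightarrow>
         dist (\<phi> 0) (y n) < \<delta> \<Longrightarrow> sum al {n..<k} \<le> T + 1 \<Longrightarrow> dist (\<phi> (sum al {n..<k})) (y k) < e / 3"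
        by (rule shadow[OF e3, of "T + 1"]) blast
      obtain J1 where J1: "\<And>j. j \<ge> J1 \<Longrightarrow> dist (y (kk (s j))) z < \<delta>"
        using s(2) \<delta> unfolding lim_sequentially by blast
      \<comment> \<open>The factor \<open>B + 1\<close> makes \<open>1 / Suc j\<close> and
        \<open>B / Suc j\<close> small at the same time: the first bounds the distance of the visit
        to \<open>x\<close>, the second the motion during the overshoot.\<close>
      obtain J2 :: nat where J2: "real J2 > (B + 1) * 3 / e" using reals_Archimedean2 by blast
      define j where "j = s (max n0 (max J1 J2))"
      have j: "j \<ge> max n0 (max J1 J2)" unfolding j_def by (rule seq_suble[OF s(1)])
      have "real (Suc j) > (B + 1) * 3 / e" using J2 j by linarith
      then have j3: "(B + 1) * (1 / Suc j) < e / 3" using e by (simp add: field_simps)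
      have j0: "B * (1 / Suc j) \<ge> 0" using B0 by simp
      have "0 < 1 / real (Suc j)" by simp
      then have j1: "1 / Suc j < e / 3" and j2: "B * (1 / Suc j) < e / 3"
        using j3 j0 unfolding distrib_right by linarith+
      let ?\<tau> = "sum al {kk j..<nn j}"
      have "?\<tau> \<le> T + 1" using kn(5)[of j] by (simp add: order_trans)
      then have "dist (\<Phi> z ?\<tau>) (y (nn j)) < e / 3"
        using kn(1)[of j] kn(2)[of j] j J1[of "max n0 (max J1 J2)"]
        by (intro sh \<Phi>d) (auto simp: \<Phi>0 dist_commute j_def[symmetric])
      moreover have "dist (\<Phi> z T) (\<Phi> z ?\<tau>) \<le> B * (1 / Suc j)"
        using kn(5)[of j] B0 by (intro order_trans[OF \<Phi>c[OF kn(4)]] mult_left_mono) (auto simp: algebra_simps)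
      moreover have "dist (y (nn j)) x < e / 3" using kn(3)[of j] j1 by linarith
      ultimately show ?thesis
        using dist_triangle[of "\<Phi> z T" x "\<Phi> z ?\<tau>"] dist_triangle[of "\<Phi> z ?\<tau>" x "y (nn j)"] j2 by linarith
    qed
    then have zx: "\<Phi> z T = x"
      by (metis dist_pos_lt dense not_less)
    have "((\<lambda>s. \<Phi> z (T + s)) has_vector_derivative F (\<Phi> z (T + t))) (at t)" for t
    proof -
      have "((\<lambda>s. T + s) has_vector_derivative 1) (at t)" by (auto intro!: derivative_eq_intros)
      from vector_diff_chain_at[OF this \<Phi>d] show ?thesis by (simp add: o_def)
    qed
    \<comment> \<open>The solution from \<open>z\<close>, shifted by \<open>T\<close>, passes
      through \<open>x\<close> at time 0, so by uniqueness it is the solution from \<open>x\<close>;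
      at time \<open>- T\<close> it is back at \<open>z\<close>.\<close>
    then have "\<Phi> z (T + (- T)) = \<Phi> x (- T)"
      by (rule lipschitz_ode_unique[OF lip _ \<Phi>d, where s = 0]) (simp add: zx \<Phi>0)
    then show ?thesis using z by (simp add: \<Phi>0)
  qed
  have inv: "\<Phi> x t \<in> A" if "x \<in> A" for x t
    using forward[OF that, of t] backward[OF that, of "- t"] by (cases "t \<ge> 0") auto
  \<comment> \<open>Two-sided invariance together with \<open>A \<subseteq> C\<close> is what
    permits replacing \<open>F\<close> by \<open>h\<close> along the whole trajectory.\<close>
  have sol: "ode_solution h S (\<Phi> x) x" if "x \<in> A" for x S
  proof -
    have "F (\<Phi> x t) = h (\<Phi> x t)" for t using Fh inv[OF that] AC by blast
    then show ?thesis
      using \<Phi>d[of x] unfolding ode_solution_def by (metis \<Phi>0 has_vector_derivative_at_within)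
  qed
  have invar: "ode_invariant h A"
    unfolding ode_invariant_def using sol inv by blast
  have chain: "\<exists>n\<ge>1. \<exists>p :: nat \<Rightarrow> 'a. p 0 = x \<and> p n = x' \<and> (\<forall>i\<le>n. p i \<in> A) \<and>
      (\<forall>i<n. \<exists>\<phi>. ode_solution h {0..} \<phi> (p i) \<and> (\<exists>t\<ge>T. dist (\<phi> t) (p (Suc i)) < \<epsilon>))"
    if x: "x \<in> A" "x' \<in> A" and \<epsilon>: "\<epsilon> > 0" and T: "T > 0" for x x' \<epsilon> T
  proof -
    define E where "E p q \<longleftrightarrow> p \<in> A \<and> q \<in> A \<and> (\<exists>t\<ge>T. dist (\<Phi> p t) q < \<epsilon>)" for p q
    have e2: "\<epsilon> / 2 > 0" using \<epsilon> by simp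
    obtain \<delta> n0 where \<delta>: "\<delta> > 0" and sh: "\<And>\<phi> n k. (\<And>t. (\<phi> has_vector_derivative F (\<phi> t)) (at t)) \<Longrightarrow> n \<ge> n0 \<Longrightarrow> k \<ge> n \<Longrightarrow>
       dist (\<phi> 0) (y n) < \<delta> \<Longrightarrow> sum al {n..<k} \<le> 2 * T + 1 \<Longrightarrow> dist (\<phi> (sum al {n..<k})) (y k) < \<epsilon> / 2"
      by (rule shadow[OF e2, of "2 * T + 1"]) blast
    obtain n1 where n1: "\<And>n. n \<ge> n1 \<Longrightarrow> infdist (y n) A < min \<delta> (\<epsilon> / 2)"
      using order_tendstoD(2)[OF conv, of "min \<delta> (\<epsilon> / 2)"] \<delta> e2 by (auto simp: eventually_sequentially)
    obtain n2 where n2: "\<And>i. i \<ge> n2 \<Longrightarrow> al i < 1" using small[of 1] by auto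
    define m where "m = max n0 (max n1 n2)"
    have step: "E p q" if "n \<ge> m" "n \<le> k" "T \<le> sum al {n..<k}" "sum al {n..<k} \<le> 2 * T + 1"
      "p \<in> A" "q \<in> A" "dist p (y n) < \<delta>" "dist (y k) q < \<epsilon> / 2" for n k p q
    proof -
      have "dist (\<Phi> p (sum al {n..<k})) (y k) < \<epsilon> / 2"
        using that by (intro sh \<Phi>d) (auto simp: \<Phi>0 m_def)
      then have "dist (\<Phi> p (sum al {n..<k})) q < \<epsilon>"
        using dist_triangle[of "\<Phi> p (sum al {n..<k})" q "y k"] that(8) by linarith
      then show ?thesis using that by (auto simp: E_def)
    qed
    \<comment> \<open>Follow the sequence itself: cut the index window into pieces of length between \<open>T\<close> and \<open>2 * T + 1\<close>
      and move every intermediate point of the sequence to a nearby point of \<open>A\<close>.\<close>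
    have chain_aux: "E\<^sup>+\<^sup>+ p q" if "n \<ge> m" "n \<le> k" "T \<le> sum al {n..<k}"
      "p \<in> A" "q \<in> A" "dist p (y n) < \<delta>" "dist (y k) q < \<epsilon> / 2" for n k p q
      using that
    proof (induction "k - n" arbitrary: n p rule: less_induct)
      case less
      show ?case
      proof (cases "sum al {n..<k} \<le> 2 * T + 1")
        case True
        then show ?thesis using step[of n k p q] less.prems by blast
      next
        case False
        have "\<And>i. i \<ge> n \<Longrightarrow> al i < 1" using n2 less.prems(1) by (simp add: m_def)
        from sum_at_top_window[OF al_ge al_sum this, where T = T] T
        obtain j where j: "j \<ge> n" "T \<le> sum al {n..<j}" "sum al {n..<j} \<le> T + 1" by auto
        have jn: "j > n" using j(1,2) T by (cases "j = n") auto
        have jk: "j \<le> k"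
        proof (rule ccontr)
          assume "\<not> j \<le> k"
          then have "sum al {n..<k} \<le> sum al {n..<j}" using al_ge by (intro sum_mono2) auto
          then show False using False j(3) T by linarith
        qed
        have "sum al {n..<k} = sum al {n..<j} + sum al {j..<k}"
          using j(1) jk by (simp add: sum.atLeastLessThan_concat)
        \<comment> \<open>Removing at most \<open>T + 1\<close> from more than
          \<open>2 * T + 1\<close> leaves at least \<open>T\<close>, hence the length bound for the
          pieces.\<close>
        then have Tj: "T \<le> sum al {j..<k}" using False j(3) by linarith
        \<comment> \<open>The point \<open>r\<close> ends one link and starts the next: distance
          below \<open>\<epsilon> / 2\<close> serves the first role, distance below
          \<open>\<delta>\<close> the second.\<close>
        have "infdist (y j) A < min \<delta> (\<epsilon> / 2)" using n1[of j] j(1) less.prems(1) by (simp add: m_def)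
        then obtain r where r: "r \<in> A" "dist (y j) r < min \<delta> (\<epsilon> / 2)"
          unfolding infdist_notempty[OF Ane] using cInf_lessD[of "dist (y j) ` A"] Ane by blast
        have "E p r" using less.prems j r T by (intro step[of n j]) auto
        moreover have "E\<^sup>+\<^sup>+ r q"
          using less.prems jn jk r Tj by (intro less.hyps[of j]) (auto simp: dist_commute)
        ultimately show ?thesis by (rule tranclp_into_tranclp2)
      qed
    qed
    obtain n where n: "n \<ge> m" "dist (y n) x < \<delta>" using AD[OF x(1) \<delta>] by blast
    have "\<And>i. i \<ge> n \<Longrightarrow> al i < 1" using n2 n(1) by (simp add: m_def)
    from sum_at_top_window[OF al_ge al_sum this, where T = T] T
    obtain K where K: "K \<ge> n" "T \<le> sum al {n..<K}" by auto
    obtain k where k: "k \<ge> K" "dist (y k) x' < \<epsilon> / 2" using AD[OF x(2) e2] by blast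
    have "T \<le> sum al {n..<k}"
      using k al_ge by (intro order_trans[OF K(2)] sum_mono2) auto
    then have "E\<^sup>+\<^sup>+ x x'"
      using chain_aux[of n k x x'] n k K x by (auto simp: dist_commute)
    then obtain N where N: "N > 0" "(E ^^ N) x x'" by (auto simp: tranclp_power)
    then obtain p where p: "p 0 = x" "p N = x'" "\<And>i. i < N \<Longrightarrow> E (p i) (p (Suc i))"
      by (auto simp: relpowp_fun_conv)
    have pA: "p i \<in> A" if "i \<le> N" for i
      using p x that by (cases i) (auto simp: E_def Suc_le_eq)
    have "\<exists>\<phi>. ode_solution h {0..} \<phi> (p i) \<and> (\<exists>t\<ge>T. dist (\<phi> t) (p (Suc i)) < \<epsilon>)" if "i < N" for i
      using p(3)[OF that] sol by (auto simp: E_def)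
    then show ?thesis
      using N(1) p pA by (intro exI[of _ N] conjI exI[of _ p]) auto
  qed
  have "internally_chain_transitive h A"
    unfolding internally_chain_transitive_def using Ane Acl invar chain by blast
  then show ?thesis using conv by blast
qed

section \<open>The Lyapunov function\<close>

lemma locally_bounded_compact:
  fixes f :: "'a::metric_space \<Rightarrow> real"
  assumes f: "locally_bounded f" and S: "compact S"
  obtains b where "b > 0" "\<And>x. x \<in> S \<Longrightarrow> \<bar>f x\<bar> \<le> b"
proof -
  obtain e where e: "\<And>x. e x > 0" "\<And>x. bounded (f ` ball x (e x))"
    using f unfolding locally_bounded_def by metis
  obtain D where D: "finite D" "S \<subseteq> (\<Union>x\<in>D. ball x (e x))"
  proof (rule compactE_image[OF S, of UNIV "\<lambda>x. ball x (e x)"])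
    show "S \<subseteq> (\<Union>x. ball x (e x))" using e(1) centre_in_ball by blast
  qed auto
  have "bounded (\<Union>x\<in>D. f ` ball x (e x))" using D(1) e(2) by (intro bounded_UN) auto
  then have "bounded (f ` S)" by (rule bounded_subset) (use D(2) in blast)
  then show thesis using that unfolding bounded_pos by auto
qed

lemma bounded_sublevel_at_infinity:
  fixes W :: "'a::real_normed_vector \<Rightarrow> real"
  assumes "filterlim W at_top at_infinity"
  obtains R where "R > 0" "\<And>x. W x \<le> r \<Longrightarrow> norm x \<le> R"
proof -
  have "eventually (\<lambda>x. W x > r) at_infinity"
    using assms by (auto simp: filterlim_at_top_dense)
  then obtain b where b: "\<And>x. norm x \<ge> b \<Longrightarrow> W x > r" by (auto simp: eventually_at_infinity)
  have "norm x \<le> max 1 b" if "W x \<le> r" for x using b[of x] that by (cases "norm x \<ge> b") auto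
  then show thesis using that[of "max 1 b"] by auto
qed

section \<open>The huber function and its composition with \<open>W\<close>\<close>

definition clip :: "real \<Rightarrow> real" where "clip p = max 0 (min 1 p)"

text \<open>The value at \<open>p\<close> of the supremum over \<open>s\<close> in the unit interval of \<open>s * p - s\<^sup>2 / 2\<close>, which is
  attained at \<open>s = clip p\<close>; this gives a convex function with derivative \<open>clip\<close>.\<close>

definition huber :: "real \<Rightarrow> real" where "huber p = clip p * p - (clip p)\<^sup>2 / 2"

lemma clip_bounds: "0 \<le> clip p" "clip p \<le> 1"
  by (auto simp: clip_def)

lemma clip_lipschitz: "\<bar>clip p - clip q\<bar> \<le> \<bar>p - q\<bar>"
  by (auto simp: clip_def)

lemma huber_ge:
  assumes "0 \<le> s" "s \<le> 1"
  shows "s * p - s\<^sup>2 / 2 \<le> huber p"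
proof -
  consider "p \<le> 0" | "0 \<le> p" "p \<le> 1" | "1 \<le> p" by linarith
  then show ?thesis
  proof cases
    case 1
    then have "huber p = 0" by (simp add: huber_def clip_def)
    moreover have "s * p \<le> 0" using 1 assms by (simp add: mult_nonneg_nonpos)
    moreover have "0 \<le> s\<^sup>2 / 2" by simp
    ultimately show ?thesis by linarith
  next
    case 2
    then have "clip p = p" by (simp add: clip_def)
    then show ?thesis using sum_squares_bound[of s p] by (simp add: huber_def power2_eq_square)
  next
    case 3
    have "(1 - s) * (2 * p - (1 + s)) \<ge> 0" using 3 assms by simp
    then show ?thesis using 3 by (simp add: huber_def clip_def algebra_simps power2_eq_square)
  qed
qed

lemma huber_nonneg: "0 \<le> huber p"
  using huber_ge[of 0 p] by simp

lemma le_huber: "p \<le> huber p + 1 / 2"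
  using huber_ge[of 1 p] by simp

text \<open>The maximizer \<open>clip q\<close> for \<open>q\<close> is also admissible in the
  supremum for \<open>p\<close>. This yields convexity with the slope taken at the endpoint
  \<open>q\<close>, without differentiating.\<close>

lemma huber_diff_le: "huber q - huber p \<le> clip q * (q - p)"
  using huber_ge[OF clip_bounds, of q p] by (simp add: huber_def[of q] algebra_simps)

text \<open>Along the segment the gradient stays within \<open>K * norm v\<close> of its value at
  \<open>x\<close>.\<close>

lemma first_order_taylor:
  fixes W :: "'a::real_inner \<Rightarrow> real"
  assumes grad: "\<And>x. GDERIV W x :> G x"
    and lip: "\<And>x z. norm (G x - G z) \<le> K * norm (x - z)"
  shows "\<bar>W (x + v) - W x - G x \<bullet> v\<bar> \<le> K * (norm v)\<^sup>2"
proof (cases "v = 0")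
  case False
  \<comment> \<open>In a trivial space the Lipschitz condition would permit a negative
    \<open>K\<close>; a nonzero \<open>v\<close> excludes this.\<close>
  have K: "K \<ge> 0"
    using lip[of v 0] False norm_ge_zero[of "G v - G 0"]
    by (metis diff_zero mult_neg_pos not_le order_trans zero_less_norm_iff)
  have "norm (W (x + v) - W x - ((x + v) - x) \<bullet> G x) \<le> norm ((x + v) - x) * (K * norm v)"
  proof (rule differentiable_bound_linearization[where S = "closed_segment x (x + v)" and f' = "\<lambda>x h. h \<bullet> G x"])
    show "x + t *\<^sub>R ((x + v) - x) \<in> closed_segment x (x + v)" if "t \<in> {0..1}" for t
      using that by (auto simp: in_segment algebra_simps intro!: exI[of _ t])
    show "(W has_derivative (\<lambda>h. h \<bullet> G z)) (at z within closed_segment x (x + v))" for z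
      using grad[of z] by (auto simp: gderiv_def intro: has_derivative_at_withinI)
    show "onorm ((\<lambda>h. h \<bullet> G z) - (\<lambda>h. h \<bullet> G x)) \<le> K * norm v" if z: "z \<in> closed_segment x (x + v)" for z
    proof (rule onorm_bound)
      show "0 \<le> K * norm v" using K by simp
      fix h :: 'a
      have "norm (z - x) \<le> norm v"
        using segment_bound(1)[OF z] by (simp add: norm_minus_commute)
      then have "norm (G z - G x) \<le> K * norm v"
        using K by (intro order_trans[OF lip] mult_left_mono)
      then have "norm h * norm (G z - G x) \<le> norm h * (K * norm v)" by (intro mult_left_mono) auto
      then show "norm (((\<lambda>h. h \<bullet> G z) - (\<lambda>h. h \<bullet> G x)) h) \<le> K * norm v * norm h"
        using Cauchy_Schwarz_ineq2[of h "G z - G x"] by (simp add: inner_diff_right mult_ac)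
    qed
  qed auto
  then show ?thesis by (simp add: inner_commute power2_eq_square mult_ac)
qed simp

text \<open>A gradient descent step of length \<open>1 / (2 * K)\<close> loses only half of its
  linear gain to the quadratic remainder. The decrease cannot exceed \<open>W x\<close>, since
  \<open>W\<close> stays nonnegative.\<close>

lemma gradient_self_bound:
  fixes W :: "'a::real_inner \<Rightarrow> real"
  assumes grad: "\<And>x. GDERIV W x :> G x"
    and lip: "\<And>x z. norm (G x - G z) \<le> K * norm (x - z)" and K: "K > 0"
    and nonneg: "\<And>x. W x \<ge> 0"
  shows "(norm (G x))\<^sup>2 \<le> 4 * K * W x"
proof -
  define s where "s = 1 / (2 * K)"
  have "\<bar>W (x + (- s) *\<^sub>R G x) - W x - G x \<bullet> ((- s) *\<^sub>R G x)\<bar> \<le> K * (norm ((- s) *\<^sub>R G x))\<^sup>2"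
    by (rule first_order_taylor[OF grad lip])
  then have "\<bar>W (x + (- s) *\<^sub>R G x) - W x + s * (norm (G x))\<^sup>2\<bar> \<le> K * s\<^sup>2 * (norm (G x))\<^sup>2"
    by (simp add: power_mult_distrib dot_square_norm)
  moreover have "K * s\<^sup>2 * (norm (G x))\<^sup>2 = s / 2 * (norm (G x))\<^sup>2"
    using K by (simp add: s_def power2_eq_square)
  moreover have "s * (norm (G x))\<^sup>2 = s / 2 * (norm (G x))\<^sup>2 + s / 2 * (norm (G x))\<^sup>2" by simp
  ultimately have "s / 2 * (norm (G x))\<^sup>2 \<le> W x"
    using nonneg[of "x + (- s) *\<^sub>R G x"] by linarith
  then show ?thesis using K by (simp add: s_def field_simps)
qed

text \<open>Convexity gives the slope \<open>c'\<close> at the new point, whereas the martingale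
  argument needs the slope \<open>c\<close> at the old one. The exchange costs
  \<open>(c' - c) * d\<close>. This vanishes if both points lie above \<open>m + 1\<close>;
  otherwise one endpoint has a bounded gradient, which makes the cost quadratic in
  \<open>v\<close>.\<close>

lemma huber_lyapunov_step:
  fixes W :: "'a::real_inner \<Rightarrow> real"
  assumes grad: "\<And>x. GDERIV W x :> G x"
    and lip: "\<And>x z. norm (G x - G z) \<le> K * norm (x - z)" and K: "K > 0"
    and nonneg: "\<And>x. W x \<ge> 0" and m: "m \<ge> 0"
  shows "\<exists>K'>0. \<forall>x v. huber (W (x + v) - m) \<le> huber (W x - m) + clip (W x - m) * (G x \<bullet> v) + K' * (norm v)\<^sup>2"
proof -
  \<comment> \<open>The square root bounds the gradient at levels up to \<open>m + 1\<close>. With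
    it \<open>b\<close> controls \<open>\<bar>d\<bar>\<close> linearly for short steps and
    quadratically for long ones.\<close>
  define b where "b = sqrt (4 * K * (m + 1)) + K"
  have b: "b > 0" using K m by (simp add: b_def add_nonneg_pos)
  define K' where "K' = K + b\<^sup>2 + b"
  have "huber (W (x + v) - m) \<le> huber (W x - m) + clip (W x - m) * (G x \<bullet> v) + K' * (norm v)\<^sup>2" for x v
  proof -
    define d c c' where "d = W (x + v) - W x" and "c = clip (W x - m)" and "c' = clip (W (x + v) - m)"
    have T: "\<bar>d - G x \<bullet> v\<bar> \<le> K * (norm v)\<^sup>2"
      unfolding d_def by (rule first_order_taylor[OF grad lip])
    \<comment> \<open>Expansion around the far endpoint, for the case that only this endpoint lies
      at level at most \<open>m + 1\<close>.\<close>
    have T': "\<bar>d - G (x + v) \<bullet> v\<bar> \<le> K * (norm v)\<^sup>2"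
      using first_order_taylor[OF grad lip, of "x + v" "- v"] by (simp add: d_def)
    have "c * (d - G x \<bullet> v) \<le> 1 * (K * (norm v)\<^sup>2)"
      using T clip_bounds K unfolding c_def by (intro order_trans[OF mult_left_mono mult_right_mono]) auto
    then have 1: "c * d \<le> c * (G x \<bullet> v) + K * (norm v)\<^sup>2" by (simp add: algebra_simps)
    have cc: "\<bar>c' - c\<bar> \<le> 1" "\<bar>c' - c\<bar> \<le> \<bar>d\<bar>"
      using clip_bounds[of "W x - m"] clip_bounds[of "W (x + v) - m"] clip_lipschitz[of "W (x + v) - m" "W x - m"]
      by (auto simp: c_def c'_def d_def)
    have 2: "(c' - c) * d \<le> (b\<^sup>2 + b) * (norm v)\<^sup>2"
    proof (cases "W x \<ge> m + 1 \<and> W (x + v) \<ge> m + 1")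
      case True
      then have "c' = c" by (simp add: c_def c'_def clip_def)
      then show ?thesis using b by simp
    next
      case False
      have *: "\<bar>G z \<bullet> v\<bar> \<le> sqrt (4 * K * (m + 1)) * norm v" if "W z \<le> m + 1" for z
      proof -
        have "(norm (G z))\<^sup>2 \<le> 4 * K * W z" by (rule gradient_self_bound[OF grad lip K nonneg])
        also have "\<dots> \<le> 4 * K * (m + 1)" using that K by simp
        finally have "norm (G z) \<le> sqrt (4 * K * (m + 1))" by (simp add: real_le_rsqrt)
        then show ?thesis
          using Cauchy_Schwarz_ineq2[of "G z" v] mult_right_mono[of "norm (G z)" _ "norm v"] norm_ge_zero
          by (meson order_trans)
      qed
      have d: "\<bar>d\<bar> \<le> sqrt (4 * K * (m + 1)) * norm v + K * (norm v)\<^sup>2"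
      proof (cases "W x \<le> m + 1")
        case True
        from *[OF this] T show ?thesis by linarith
      next
        case F: False
        then have "W (x + v) \<le> m + 1" using False by linarith
        from *[OF this] T' show ?thesis by linarith
      qed
      have prod: "(c' - c) * d \<le> \<bar>c' - c\<bar> * \<bar>d\<bar>" by (simp add: abs_mult[symmetric])
      show ?thesis
      \<comment> \<open>For short steps both factors are linear in \<open>norm v\<close>, which
        costs \<open>b\<^sup>2\<close>. For long steps \<open>\<bar>c' - c\<bar> \<le> 1\<close> is
        better, and \<open>b\<close> suffices.\<close>
      proof (cases "norm v \<le> 1")
        case True
        then have "(norm v)\<^sup>2 \<le> norm v" by (simp add: power2_eq_square mult_left_le)
        then have "K * (norm v)\<^sup>2 \<le> K * norm v" using K by simp
        then have "\<bar>d\<bar> \<le> b * norm v" using d by (simp add: b_def algebra_simps)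
        then have "\<bar>c' - c\<bar> * \<bar>d\<bar> \<le> (b * norm v) * (b * norm v)" using cc by (intro mult_mono) auto
        also have "\<dots> \<le> (b\<^sup>2 + b) * (norm v)\<^sup>2" using b by (simp add: power2_eq_square algebra_simps)
        finally show ?thesis using prod by linarith
      next
        case False
        then have "norm v \<le> (norm v)\<^sup>2" by (simp add: power2_eq_square mult_left_mono[of 1 "norm v" "norm v", simplified])
        then have "sqrt (4 * K * (m + 1)) * norm v \<le> sqrt (4 * K * (m + 1)) * (norm v)\<^sup>2"
          using K m by (intro mult_left_mono) auto
        then have "\<bar>d\<bar> \<le> b * (norm v)\<^sup>2" using d by (simp add: b_def algebra_simps)
        then have "\<bar>c' - c\<bar> * \<bar>d\<bar> \<le> 1 * (b * (norm v)\<^sup>2)" using cc by (intro mult_mono) auto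
        also have "\<dots> \<le> (b\<^sup>2 + b) * (norm v)\<^sup>2" using b by (simp add: algebra_simps)
        finally show ?thesis using prod by linarith
      qed
    qed
    have "huber (W (x + v) - m) - huber (W x - m) \<le> c' * d"
      using huber_diff_le[of "W (x + v) - m" "W x - m"] by (simp add: c'_def d_def)
    also have "\<dots> = c * d + (c' - c) * d" by (simp add: algebra_simps)
    finally show ?thesis using 1 2 unfolding K'_def c_def by (simp add: algebra_simps)
  qed
  moreover have "K' > 0" using K b by (simp add: K'_def add_pos_nonneg add_pos_pos)
  ultimately show ?thesis by blast
qed

lemma bounded_hessian_imp_lipschitz_gradient:
  fixes G :: "real ^ 'd \<Rightarrow> real ^ 'd" and H :: "real ^ 'd \<Rightarrow> real ^ 'd ^ 'd"
  assumes d: "\<And>x. (G has_derivative (\<lambda>v. H x *v v)) (at x)"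
    and C: "\<And>x i j. \<bar>H x $ i $ j\<bar> \<le> C"
  shows "\<exists>K>0. \<forall>x z. norm (G x - G z) \<le> K * norm (x - z)"
proof -
  \<comment> \<open>The product bounds the operator norm of the Hessian; adding 1 keeps
    \<open>K\<close> positive when the Hessian vanishes.\<close>
  define K where "K = real CARD('d) * real CARD('d) * C + 1"
  have C0: "C \<ge> 0" using C[of 0 undefined undefined] by linarith
  have "norm (G x - G z) \<le> K * norm (x - z)" for x z
  proof (rule differentiable_bound[of UNIV G "\<lambda>x v. H x *v v"])
    show "onorm (\<lambda>v. H x *v v) \<le> K" for x
      using onorm_le_matrix_component[of "H x" C] C by (simp add: K_def)
  qed (use d in auto)
  moreover have "K > 0" using C0 by (simp add: K_def add_nonneg_pos)
  ultimately show ?thesis by blast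
qed

text \<open>For finite \<open>N\<close>, compactness covers the levels up to \<open>N\<close> and
  the lower bound on \<open>g\<close> those above. For infinite \<open>N\<close>, compactness covers
  the levels below \<open>m\<close> and the constant \<open>c\<close> the rest. Both choices end in
  one bound, after which \<open>N\<close> no longer matters.\<close>

lemma scaled_growth_bound:
  fixes h :: "'a::euclidean_space \<Rightarrow> 'a" and W f g :: "'a \<Rightarrow> real" and m :: nat
  assumes h: "continuous_on UNIV h"
    and f: "locally_bounded f" "\<And>x. f x \<ge> 0"
    and W: "\<And>x. W x \<ge> 0" "filterlim W at_top at_infinity" and m: "m > 0"
    and N: "enat m < N"
    and c: "max 1 (SUP z \<in> closure (sublevel W (ereal_of_enat N)) - sublevel W (ereal (real m)).
              ereal (((norm (h z))\<^sup>2 + f z) / W z)) < ereal c"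
    and g: "\<And>z. g z \<ge> max 1 (if ereal (W z) > ereal_of_enat N
                            then sqrt (((norm (h z))\<^sup>2 + f z) / W z) else 0)"
  shows "\<exists>C>0. \<forall>z. (norm (h z))\<^sup>2 + f z \<le> C * (g z)\<^sup>2 * (1 + W z)"
proof -
  have level: "\<exists>b>0. \<forall>z. W z \<le> r \<longrightarrow> (norm (h z))\<^sup>2 + f z \<le> b" for r
  proof -
    obtain R where R: "R > 0" "\<And>x. W x \<le> r \<Longrightarrow> norm x \<le> R"
      using bounded_sublevel_at_infinity[OF W(2), where r = r] by blast
    obtain b1 where b1: "b1 > 0" "\<And>x. x \<in> cball 0 R \<Longrightarrow> \<bar>f x\<bar> \<le> b1"
      using locally_bounded_compact[OF f(1) compact_cball] by blast
    have "compact ((\<lambda>z. (norm (h z))\<^sup>2) ` cball 0 R)"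
      by (intro compact_continuous_image continuous_intros continuous_on_subset[OF h]) auto
    from compact_imp_bounded[OF this] obtain b2 where b2: "b2 > 0" "\<And>x. x \<in> cball 0 R \<Longrightarrow> (norm (h x))\<^sup>2 \<le> b2"
      unfolding bounded_pos by auto
    have "(norm (h z))\<^sup>2 + f z \<le> b1 + b2" if "W z \<le> r" for z
      using b1(2)[of z] b2(2)[of z] R(2)[OF that] by (simp add: abs_le_iff)
    then show ?thesis using b1(1) b2(1) by (intro exI[of _ "b1 + b2"]) auto
  qed
  have g1: "(g z)\<^sup>2 \<ge> 1" for z using g[of z] by (simp add: one_le_power)
  \<comment> \<open>The right-hand side dominates both 1 and \<open>W\<close>, so it absorbs
    constants from compact regions as well as multiples of \<open>W\<close> from outside.\<close>
  have gW: "(g z)\<^sup>2 * (1 + W z) \<ge> 1" "(g z)\<^sup>2 * (1 + W z) \<ge> W z" for z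
    using mult_mono[OF g1[of z], of 1 "1 + W z"] mult_mono[OF g1[of z], of "W z" "1 + W z"] W(1)[of z]
    by auto
  have c1: "c > 1" using c by simp
  show ?thesis
  proof (cases N)
    case (enat k)
    obtain b where b: "b > 0" "\<And>z. W z \<le> real k \<Longrightarrow> (norm (h z))\<^sup>2 + f z \<le> b" using level by blast
    have "(norm (h z))\<^sup>2 + f z \<le> (b + 1) * ((g z)\<^sup>2 * (1 + W z))" for z
    proof (cases "W z \<le> real k")
      case True
      have "(norm (h z))\<^sup>2 + f z \<le> (b + 1) * 1" using b(2)[OF True] by simp
      also have "\<dots> \<le> (b + 1) * ((g z)\<^sup>2 * (1 + W z))" using b(1) gW by (intro mult_left_mono) auto
      finally show ?thesis .
    next
      case False
      have Wp: "W z > 0" using False by linarith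
      have "sqrt (((norm (h z))\<^sup>2 + f z) / W z) \<le> g z" using g[of z] False by (simp add: enat)
      then have "(sqrt (((norm (h z))\<^sup>2 + f z) / W z))\<^sup>2 \<le> (g z)\<^sup>2"
        using f(2)[of z] Wp by (intro power_mono) auto
      then have "((norm (h z))\<^sup>2 + f z) / W z \<le> (g z)\<^sup>2" using f(2)[of z] Wp by simp
      then have "(norm (h z))\<^sup>2 + f z \<le> (g z)\<^sup>2 * W z" using Wp by (simp add: field_simps)
      also have "\<dots> \<le> 1 * ((g z)\<^sup>2 * (1 + W z))" by (simp add: algebra_simps)
      also have "\<dots> \<le> (b + 1) * ((g z)\<^sup>2 * (1 + W z))" using b(1) gW(1)[of z] by (intro mult_right_mono) auto
      finally show ?thesis .
    qed
    then show ?thesis using b(1) by (intro exI[of _ "b + 1"]) (auto simp: mult.assoc)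
  next
    case infinity
    obtain b where b: "b > 0" "\<And>z. W z \<le> real m \<Longrightarrow> (norm (h z))\<^sup>2 + f z \<le> b" using level by blast
    have "(norm (h z))\<^sup>2 + f z \<le> (b + c) * ((g z)\<^sup>2 * (1 + W z))" for z
    proof (cases "W z < real m")
      case True
      then have "(norm (h z))\<^sup>2 + f z \<le> (b + c) * 1" using b(2)[of z] c1 by simp
      also have "\<dots> \<le> (b + c) * ((g z)\<^sup>2 * (1 + W z))" using b(1) c1 gW by (intro mult_left_mono) auto
      finally show ?thesis .
    next
      case False
      have Wp: "W z > 0" using False m by linarith
      have "z \<in> closure (sublevel W (ereal_of_enat N)) - sublevel W (ereal (real m))"
        using False closure_subset[of "sublevel W (ereal_of_enat N)"] by (auto simp: infinity sublevel_def)
      then have "ereal (((norm (h z))\<^sup>2 + f z) / W z) \<le> max 1 (SUP z \<in> closure (sublevel W (ereal_of_enat N)) - sublevel W (ereal (real m)).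
              ereal (((norm (h z))\<^sup>2 + f z) / W z))"
        by (intro max.coboundedI2 SUP_upper)
      then have "((norm (h z))\<^sup>2 + f z) / W z < c" using order.strict_trans1[OF _ c] by fastforce
      then have "(norm (h z))\<^sup>2 + f z \<le> c * W z" using Wp by (simp add: field_simps)
      also have "\<dots> \<le> (b + c) * ((g z)\<^sup>2 * (1 + W z))"
        using b(1) c1 gW[of z] W(1)[of z] by (intro mult_mono) auto
      finally show ?thesis .
    qed
    then show ?thesis using b(1) c1 by (intro exI[of _ "b + c"]) (auto simp: mult.assoc)
  qed
qed

section \<open>Nonnegative supermartingales\<close>

lemma borel_measurable_vec_nth [measurable (raw)]:
  fixes f :: "'b \<Rightarrow> real ^ 'd"
  shows "f \<in> borel_measurable M \<Longrightarrow> (\<lambda>x. f x $ i) \<in> borel_measurable M"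
  by (rule borel_measurable_continuous_on[where f = "\<lambda>x. x $ i"]) (intro continuous_intros)

text \<open>Truncating to the event where \<open>V\<close>, \<open>\<xi>\<close> and \<open>\<beta>\<close> are bounded makes the martingale term integrable;
  the truncation is then removed by monotone convergence, so that neither side has to be integrable.\<close>

lemma conditional_one_step:
  fixes M' \<xi> :: "'w \<Rightarrow> real ^ 'd"
  assumes P: "prob_space P" and sub: "subalgebra P F"
    and M': "M' \<in> borel_measurable P" and M2: "integrable P (\<lambda>\<omega>. (norm (M' \<omega>))\<^sup>2)"
    and M0: "\<And>i. AE \<omega> in P. real_cond_exp P F (\<lambda>\<omega>. M' \<omega> $ i) \<omega> = 0"
    and Mf: "AE \<omega> in P. real_cond_exp P F (\<lambda>\<omega>. (norm (M' \<omega>))\<^sup>2) \<omega> \<le> fy \<omega>"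
    and measF: "V \<in> borel_measurable F" "\<xi> \<in> borel_measurable F" "\<beta> \<in> borel_measurable F"
    and meas: "U' \<in> borel_measurable P" "U \<in> borel_measurable P"
    and nonneg: "\<And>\<omega>. \<omega> \<in> space P \<Longrightarrow> V \<omega> \<ge> 0" "\<And>\<omega>. \<omega> \<in> space P \<Longrightarrow> \<beta> \<omega> \<ge> 0" "\<And>\<omega>. \<omega> \<in> space P \<Longrightarrow> U' \<omega> \<ge> 0"
    and step: "\<And>\<omega>. \<omega> \<in> space P \<Longrightarrow> U' \<omega> \<le> V \<omega> + \<xi> \<omega> \<bullet> M' \<omega> + \<beta> \<omega> * (norm (M' \<omega>))\<^sup>2"
    and U: "\<And>\<omega>. \<omega> \<in> space P \<Longrightarrow> V \<omega> + \<beta> \<omega> * fy \<omega> \<le> U \<omega>"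
    and A: "A \<in> sets F"
  shows "(\<integral>\<^sup>+\<omega>\<in>A. ennreal (U' \<omega>) \<partial>P) \<le> (\<integral>\<^sup>+\<omega>\<in>A. ennreal (U \<omega>) \<partial>P)"
proof -
  interpret prob_space P by (rule P)
  interpret finite_measure_subalgebra P F
    by (unfold_locales) (rule sub)
  have spF: "space F = space P" and setsF: "sets F \<subseteq> sets P" using sub by (auto simp: subalgebra_def)
  note [measurable] = measF
  have measP [measurable]: "V \<in> borel_measurable P" "\<xi> \<in> borel_measurable P" "\<beta> \<in> borel_measurable P"
    using measF by (auto intro: measurable_from_subalg[OF sub])
  note [measurable] = M' meas
  have M1: "integrable P (\<lambda>\<omega>. M' \<omega> $ i)" for i
  proof (rule Bochner_Integration.integrable_bound)
    show "integrable P (\<lambda>\<omega>. 1 + (norm (M' \<omega>))\<^sup>2)" using M2 by simp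
    show "AE \<omega> in P. norm (M' \<omega> $ i) \<le> norm (1 + (norm (M' \<omega>))\<^sup>2)"
    proof (rule AE_I2)
      fix \<omega>
      have "\<bar>M' \<omega> $ i\<bar> \<le> norm (M' \<omega>)" by (rule component_le_norm_cart)
      also have "\<dots> \<le> 1 + (norm (M' \<omega>))\<^sup>2"
        using sum_squares_bound[of 1 "norm (M' \<omega>)"] norm_ge_zero[of "M' \<omega>"]
        by (simp only: mult_1_right mult_1_left one_power2)
      finally show "norm (M' \<omega> $ i) \<le> norm (1 + (norm (M' \<omega>))\<^sup>2)" by simp
    qed
  qed simp
  define C where "C k = A \<inter> {\<omega> \<in> space F. V \<omega> \<le> real k \<and> norm (\<xi> \<omega>) \<le> real k \<and> \<beta> \<omega> \<le> real k}" for k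
  have CF [measurable]: "C k \<in> sets F" for k using A unfolding C_def by measurable
  have CP [measurable]: "C k \<in> sets P" for k using CF setsF by auto
  have CA: "C k \<subseteq> A" for k by (auto simp: C_def)
  have Cb: "V \<omega> \<le> real k" "norm (\<xi> \<omega>) \<le> real k" "\<beta> \<omega> \<le> real k" "\<omega> \<in> space P" if "\<omega> \<in> C k" for \<omega> k
    using that by (auto simp: C_def spF)
  let ?I = "\<lambda>k \<omega>. indicator (C k) \<omega> :: real"
  have trunc: "(\<integral>\<^sup>+\<omega>\<in>C k. ennreal (U' \<omega>) \<partial>P) \<le> (\<integral>\<^sup>+\<omega>\<in>A. ennreal (U \<omega>) \<partial>P)" for k
  proof -
    have i0: "integrable P (\<lambda>\<omega>. ?I k \<omega> * V \<omega>)"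
      by (rule integrable_const_bound[of _ "real k"])
         (use nonneg Cb in \<open>auto simp: indicator_def\<close>)
    have i1: "integrable P (\<lambda>\<omega>. (?I k \<omega> * \<xi> \<omega> $ i) * M' \<omega> $ i)" for i
    proof (rule Bochner_Integration.integrable_bound)
      show "integrable P (\<lambda>\<omega>. real k * M' \<omega> $ i)" using M1 by simp
      show "AE \<omega> in P. norm (?I k \<omega> * \<xi> \<omega> $ i * M' \<omega> $ i) \<le> norm (real k * M' \<omega> $ i)"
      proof (rule AE_I2)
        fix \<omega>
        have "\<bar>\<xi> \<omega> $ i\<bar> \<le> real k" if "\<omega> \<in> C k"
          using Cb(2)[OF that] component_le_norm_cart[of "\<xi> \<omega>" i] by linarith
        then show "norm (?I k \<omega> * \<xi> \<omega> $ i * M' \<omega> $ i) \<le> norm (real k * M' \<omega> $ i)"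
          by (auto simp: indicator_def abs_mult mult_right_mono)
      qed
    qed simp
    have i2: "integrable P (\<lambda>\<omega>. (?I k \<omega> * \<beta> \<omega>) * (norm (M' \<omega>))\<^sup>2)"
    proof (rule Bochner_Integration.integrable_bound)
      show "integrable P (\<lambda>\<omega>. real k * (norm (M' \<omega>))\<^sup>2)" using M2 by simp
      show "AE \<omega> in P. norm (?I k \<omega> * \<beta> \<omega> * (norm (M' \<omega>))\<^sup>2) \<le> norm (real k * (norm (M' \<omega>))\<^sup>2)"
        by (rule AE_I2) (use nonneg Cb in \<open>auto simp: indicator_def abs_mult mult_right_mono\<close>)
    qed simp
    let ?c = "\<lambda>i. real_cond_exp P F (\<lambda>\<omega>. M' \<omega> $ i)" and ?q = "real_cond_exp P F (\<lambda>\<omega>. (norm (M' \<omega>))\<^sup>2)"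
    have mF: "(\<lambda>\<omega>. ?I k \<omega> * \<xi> \<omega> $ i) \<in> borel_measurable F" "(\<lambda>\<omega>. ?I k \<omega> * \<beta> \<omega>) \<in> borel_measurable F" for i
      by measurable
    have e1: "(\<integral>\<omega>. (?I k \<omega> * \<xi> \<omega> $ i) * M' \<omega> $ i \<partial>P) = 0" for i
    proof -
      have "(\<integral>\<omega>. (?I k \<omega> * \<xi> \<omega> $ i) * M' \<omega> $ i \<partial>P) = (\<integral>\<omega>. (?I k \<omega> * \<xi> \<omega> $ i) * ?c i \<omega> \<partial>P)"
        using real_cond_exp_intg(2)[OF i1 mF(1)] by simp
      also have "\<dots> = (\<integral>\<omega>. 0 \<partial>P)"
        by (rule integral_cong_AE) (use M0[of i] in auto)
      finally show ?thesis by simp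
    qed
    have e2: "(\<integral>\<omega>. (?I k \<omega> * \<beta> \<omega>) * (norm (M' \<omega>))\<^sup>2 \<partial>P) = (\<integral>\<omega>. (?I k \<omega> * \<beta> \<omega>) * ?q \<omega> \<partial>P)"
      and i3: "integrable P (\<lambda>\<omega>. (?I k \<omega> * \<beta> \<omega>) * ?q \<omega>)"
      using real_cond_exp_intg[OF i2 mF(2)] by simp_all
    \<comment> \<open>The inner product is written in coordinates because the conditional
      expectation is taken of real functions, one coordinate at a time.\<close>
    let ?R = "\<lambda>\<omega>. ?I k \<omega> * V \<omega> + (\<Sum>i\<in>UNIV. (?I k \<omega> * \<xi> \<omega> $ i) * M' \<omega> $ i) + (?I k \<omega> * \<beta> \<omega>) * (norm (M' \<omega>))\<^sup>2"
    have R: "?I k \<omega> * U' \<omega> \<le> ?R \<omega>" if "\<omega> \<in> space P" for \<omega>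
    proof (cases "\<omega> \<in> C k")
      case True
      then show ?thesis using step[OF that] by (simp add: inner_vec_def)
    qed simp
    have iR: "integrable P ?R" using i0 i1 i2 by (intro Bochner_Integration.integrable_add Bochner_Integration.integrable_sum) auto
    have "(\<integral>\<^sup>+\<omega>\<in>C k. ennreal (U' \<omega>) \<partial>P) = (\<integral>\<^sup>+\<omega>. ennreal (?I k \<omega> * U' \<omega>) \<partial>P)"
      by (intro nn_integral_cong) (auto simp: indicator_def)
    also have "\<dots> \<le> (\<integral>\<^sup>+\<omega>. ennreal (?R \<omega>) \<partial>P)"
      by (intro nn_integral_mono ennreal_leI R)
    \<comment> \<open>\<open>?R\<close> may be treated as a nonnegative integrand since it dominates
      the truncated \<open>U'\<close>, although its martingale term has no sign.\<close>
    also have "\<dots> = ennreal (\<integral>\<omega>. ?R \<omega> \<partial>P)"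
    proof (rule nn_integral_eq_integral[OF iR AE_I2])
      fix \<omega> assume \<omega>: "\<omega> \<in> space P"
      have "0 \<le> ?I k \<omega> * U' \<omega>" using nonneg(3)[OF \<omega>] by simp
      then show "0 \<le> ?R \<omega>" using R[OF \<omega>] by linarith
    qed
    also have "(\<integral>\<omega>. ?R \<omega> \<partial>P) = (\<integral>\<omega>. ?I k \<omega> * V \<omega> + (?I k \<omega> * \<beta> \<omega>) * ?q \<omega> \<partial>P)"
      using i0 i1 i2 i3 by (simp add: Bochner_Integration.integral_add Bochner_Integration.integral_sum e1 e2)
    also have "ennreal \<dots> = (\<integral>\<^sup>+\<omega>. ennreal (?I k \<omega> * V \<omega> + (?I k \<omega> * \<beta> \<omega>) * ?q \<omega>) \<partial>P)"
    proof (rule nn_integral_eq_integral[symmetric])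
      have "AE \<omega> in P. ?q \<omega> \<ge> 0" by (rule real_cond_exp_pos) auto
      then show "AE \<omega> in P. 0 \<le> ?I k \<omega> * V \<omega> + (?I k \<omega> * \<beta> \<omega>) * ?q \<omega>"
        using AE_space by eventually_elim (use nonneg in \<open>auto simp: indicator_def\<close>)
    qed (use i0 i3 in simp)
    also have "\<dots> \<le> (\<integral>\<^sup>+\<omega>\<in>A. ennreal (U \<omega>) \<partial>P)"
    proof (rule nn_integral_mono_AE)
      show "AE \<omega> in P. ennreal (?I k \<omega> * V \<omega> + (?I k \<omega> * \<beta> \<omega>) * ?q \<omega>) \<le> ennreal (U \<omega>) * indicator A \<omega>"
        using Mf AE_space
      proof eventually_elim
        case (elim \<omega>)
        then have "V \<omega> + \<beta> \<omega> * ?q \<omega> \<le> U \<omega>"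
          using U[of \<omega>] mult_left_mono[OF elim(1) nonneg(2)] by fastforce
        then show ?case using CA[of k] by (auto simp: indicator_def intro: ennreal_leI)
      qed
    qed
    finally show ?thesis .
  qed
  have Ain: "A \<in> sets P" using A setsF by auto
  have UC: "(\<Union>k. C k) = A"
  proof -
    have "\<exists>k. \<omega> \<in> C k" if "\<omega> \<in> A" for \<omega>
    proof -
      obtain k :: nat where "max (V \<omega>) (max (norm (\<xi> \<omega>)) (\<beta> \<omega>)) \<le> real k" using real_arch_simple by blast
      then have "\<omega> \<in> C k" using that sets.sets_into_space[OF A] by (auto simp: C_def)
      then show ?thesis by blast
    qed
    then show ?thesis using CA by blast
  qed
  have "incseq C" by (rule incseq_SucI) (auto simp: C_def)
  \<comment> \<open>Monotone convergence in \<open>k\<close> is obtained as continuity from below of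
    the measure with density \<open>U'\<close>.\<close>
  have dens: "emeasure (density P (\<lambda>\<omega>. ennreal (U' \<omega>))) B = (\<integral>\<^sup>+\<omega>\<in>B. ennreal (U' \<omega>) \<partial>P)" if "B \<in> sets P" for B
    using that by (intro emeasure_density) auto
  have "(SUP k. emeasure (density P (\<lambda>\<omega>. ennreal (U' \<omega>))) (C k)) = emeasure (density P (\<lambda>\<omega>. ennreal (U' \<omega>))) (\<Union>k. C k)"
    by (rule SUP_emeasure_incseq) (use CP \<open>incseq C\<close> in auto)
  then have "(\<integral>\<^sup>+\<omega>\<in>A. ennreal (U' \<omega>) \<partial>P) = (SUP k. \<integral>\<^sup>+\<omega>\<in>C k. ennreal (U' \<omega>) \<partial>P)"
    unfolding UC dens[OF Ain] dens[OF CP] by (rule sym)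
  also have "\<dots> \<le> (\<integral>\<^sup>+\<omega>\<in>A. ennreal (U \<omega>) \<partial>P)" by (rule SUP_least) (rule trunc)
  finally show ?thesis .
qed

text \<open>Stop when \<open>Z\<close> first reaches \<open>c\<close>: the integral of
  \<open>Z\<close> over the paths not yet stopped, plus \<open>c\<close> times the measure of the
  stopped ones, never increases. The starting event \<open>B\<close> serves to localize when
  \<open>Z 0\<close> has infinite integral.\<close>

lemma nonneg_supermartingale_maximal:
  fixes Z :: "nat \<Rightarrow> 'w \<Rightarrow> real"
  assumes sub: "\<And>n. subalgebra P (F n)" and mono: "\<And>n. sets (F n) \<subseteq> sets (F (Suc n))"
    and Z: "\<And>n. Z n \<in> borel_measurable (F n)"
    and step: "\<And>n A. A \<in> sets (F n) \<Longrightarrow> (\<integral>\<^sup>+\<omega>\<in>A. ennreal (Z (Suc n) \<omega>) \<partial>P) \<le> (\<integral>\<^sup>+\<omega>\<in>A. ennreal (Z n \<omega>) \<partial>P)"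
    and B: "B \<in> sets (F 0)"
  shows "ennreal c * emeasure P {\<omega> \<in> B. \<exists>k. Z k \<omega> \<ge> c} \<le> (\<integral>\<^sup>+\<omega>\<in>B. ennreal (Z 0 \<omega>) \<partial>P)"
proof -
  have spF: "space (F n) = space P" and setsF: "sets (F n) \<subseteq> sets P" for n
    using sub[of n] by (auto simp: subalgebra_def)
  have ZP [measurable]: "Z n \<in> borel_measurable P" for n using Z by (auto intro: measurable_from_subalg[OF sub])
  define A where "A n = {\<omega> \<in> B. \<forall>k<n. Z k \<omega> < c}" for n
  have mF: "Z n -` S \<inter> space P \<in> sets (F n)" if "S \<in> sets borel" for n S
    using measurable_sets[OF Z that] by (simp add: spF)
  have Bsp: "B \<subseteq> space P" using B setsF sets.sets_into_space by blast
  have ASuc: "A (Suc n) = A n \<inter> (Z n -` {..<c} \<inter> space P)" for n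
    using Bsp by (auto simp: A_def less_Suc_eq)
  have AF: "A n \<in> sets (F n)" for n
  proof (induction n)
    case 0
    then show ?case using B by (simp add: A_def)
  next
    case (Suc n)
    have "A n \<inter> (Z n -` {..<c} \<inter> space P) \<in> sets (F n)" using Suc mF[of "{..<c}" n] by (rule sets.Int) simp
    then show ?case using mono ASuc by auto
  qed
  have AP [measurable]: "A n \<in> sets P" for n using AF setsF by auto
  have BP [measurable]: "B \<in> sets P" using B setsF by auto
  have claim: "(\<integral>\<^sup>+\<omega>\<in>A n. ennreal (Z n \<omega>) \<partial>P) + ennreal c * emeasure P (B - A n) \<le> (\<integral>\<^sup>+\<omega>\<in>B. ennreal (Z 0 \<omega>) \<partial>P)" for n
  proof (induction n)
    case 0
    then show ?case by (simp add: A_def)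
  next
    case (Suc n)
    have sub: "A (Suc n) \<subseteq> A n" "A n \<subseteq> B" by (auto simp: A_def)
    have "ennreal c * emeasure P (A n - A (Suc n)) = (\<integral>\<^sup>+\<omega>\<in>A n - A (Suc n). ennreal c \<partial>P)"
      by (simp add: nn_integral_cmult_indicator)
    also have "\<dots> \<le> (\<integral>\<^sup>+\<omega>\<in>A n - A (Suc n). ennreal (Z n \<omega>) \<partial>P)"
      using Bsp sub by (intro nn_integral_mono) (auto simp: ASuc indicator_def intro: ennreal_leI)
    finally have 1: "ennreal c * emeasure P (A n - A (Suc n)) \<le> (\<integral>\<^sup>+\<omega>\<in>A n - A (Suc n). ennreal (Z n \<omega>) \<partial>P)" .
    have S: "A (Suc n) \<in> sets (F n)"
      unfolding ASuc using AF[of n] mF[of "{..<c}" n] by (rule sets.Int) simp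
    have "(\<integral>\<^sup>+\<omega>\<in>A (Suc n). ennreal (Z (Suc n) \<omega>) \<partial>P) + ennreal c * emeasure P (A n - A (Suc n)) \<le>
       (\<integral>\<^sup>+\<omega>\<in>A (Suc n). ennreal (Z n \<omega>) \<partial>P) + (\<integral>\<^sup>+\<omega>\<in>A n - A (Suc n). ennreal (Z n \<omega>) \<partial>P)"
      by (intro add_mono step[OF S] 1)
    also have "\<dots> = (\<integral>\<^sup>+\<omega>\<in>A n. ennreal (Z n \<omega>) \<partial>P)"
      using sub by (subst nn_integral_add[symmetric]) (auto intro!: nn_integral_cong simp: indicator_def)
    finally have 2: "(\<integral>\<^sup>+\<omega>\<in>A (Suc n). ennreal (Z (Suc n) \<omega>) \<partial>P) + ennreal c * emeasure P (A n - A (Suc n))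
       \<le> (\<integral>\<^sup>+\<omega>\<in>A n. ennreal (Z n \<omega>) \<partial>P)" .
    have "emeasure P (B - A (Suc n)) = emeasure P ((A n - A (Suc n)) \<union> (B - A n))"
      using sub by (intro arg_cong[where f = "emeasure P"]) auto
    also have "\<dots> = emeasure P (A n - A (Suc n)) + emeasure P (B - A n)"
      by (rule plus_emeasure[symmetric]) auto
    finally have "(\<integral>\<^sup>+\<omega>\<in>A (Suc n). ennreal (Z (Suc n) \<omega>) \<partial>P) + ennreal c * emeasure P (B - A (Suc n)) =
       ((\<integral>\<^sup>+\<omega>\<in>A (Suc n). ennreal (Z (Suc n) \<omega>) \<partial>P) + ennreal c * emeasure P (A n - A (Suc n))) + ennreal c * emeasure P (B - A n)"
      by (simp add: distrib_left add.assoc)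
    also have "\<dots> \<le> (\<integral>\<^sup>+\<omega>\<in>A n. ennreal (Z n \<omega>) \<partial>P) + ennreal c * emeasure P (B - A n)"
      by (intro add_right_mono 2)
    finally show ?case using Suc by (rule order_trans)
  qed
  have "(SUP n. emeasure P (B - A n)) = emeasure P (\<Union>n. B - A n)"
    by (rule SUP_emeasure_incseq) (auto intro!: incseq_SucI simp: A_def)
  also have "(\<Union>n. B - A n) = {\<omega> \<in> B. \<exists>k. Z k \<omega> \<ge> c}"
    by (auto simp: A_def not_less) (meson lessI not_less)
  finally have eq: "(SUP n. emeasure P (B - A n)) = emeasure P {\<omega> \<in> B. \<exists>k. Z k \<omega> \<ge> c}" .
  have "ennreal c * emeasure P {\<omega> \<in> B. \<exists>k. Z k \<omega> \<ge> c} = (SUP n. ennreal c * emeasure P (B - A n))"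
    unfolding eq[symmetric] by (rule SUP_mult_left_ennreal)
  also have "\<dots> \<le> (\<integral>\<^sup>+\<omega>\<in>B. ennreal (Z 0 \<omega>) \<partial>P)"
  proof (rule SUP_least)
    show "ennreal c * emeasure P (B - A n) \<le> (\<integral>\<^sup>+\<omega>\<in>B. ennreal (Z 0 \<omega>) \<partial>P)" for n
      by (rule order_trans[OF _ claim[of n]]) simp
  qed
  finally show ?thesis .
qed

text \<open>On \<open>Z 0 \<le> c\<close> the maximal inequality bounds the probability of ever
  reaching level \<open>j\<close> by \<open>c / j\<close>, so unbounded paths are null there.
  Countably many values of \<open>c\<close> exhaust the space.\<close>

lemma nonneg_supermartingale_AE_bdd_above:
  fixes Z :: "nat \<Rightarrow> 'w \<Rightarrow> real"
  assumes P: "prob_space P"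
    and sub: "\<And>n. subalgebra P (F n)" and mono: "\<And>n. sets (F n) \<subseteq> sets (F (Suc n))"
    and Z: "\<And>n. Z n \<in> borel_measurable (F n)"
    and step: "\<And>n A. A \<in> sets (F n) \<Longrightarrow> (\<integral>\<^sup>+\<omega>\<in>A. ennreal (Z (Suc n) \<omega>) \<partial>P) \<le> (\<integral>\<^sup>+\<omega>\<in>A. ennreal (Z n \<omega>) \<partial>P)"
  shows "AE \<omega> in P. bdd_above (range (\<lambda>n. Z n \<omega>))"
proof -
  interpret prob_space P by (rule P)
  have spF: "space (F n) = space P" for n using sub[of n] by (auto simp: subalgebra_def)
  have ZP [measurable]: "Z n \<in> borel_measurable P" for n using Z by (auto intro: measurable_from_subalg[OF sub])
  define D where "D c = {\<omega> \<in> space P. Z 0 \<omega> \<le> real c \<and> (\<forall>j::nat. \<exists>k. Z k \<omega> \<ge> real j)}" for c :: nat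
  have DP [measurable]: "D c \<in> sets P" for c unfolding D_def by measurable
  have D0: "prob (D c) = 0" for c
  proof -
    define B where "B = {\<omega> \<in> space P. Z 0 \<omega> \<le> real c}"
    have BF: "B \<in> sets (F 0)"
    proof -
      have "{\<omega> \<in> space (F 0). Z 0 \<omega> \<le> real c} \<in> sets (F 0)" using Z[of 0] by measurable
      then show ?thesis by (simp add: B_def spF)
    qed
    have B [measurable]: "B \<in> sets P" unfolding B_def by measurable
    have bound: "real j * prob (D c) \<le> real c" for j :: nat
    proof -
      have "ennreal (real j) * emeasure P (D c) \<le> ennreal (real j) * emeasure P {\<omega> \<in> B. \<exists>k. Z k \<omega> \<ge> real j}"
      proof (rule mult_left_mono[OF emeasure_mono])
        show "D c \<subseteq> {\<omega> \<in> B. \<exists>k. Z k \<omega> \<ge> real j}" by (auto simp: D_def B_def)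
        have "{\<omega> \<in> B. \<exists>k. Z k \<omega> \<ge> real j} = B \<inter> {\<omega> \<in> space P. \<exists>k. Z k \<omega> \<ge> real j}" by (auto simp: B_def)
        then show "{\<omega> \<in> B. \<exists>k. Z k \<omega> \<ge> real j} \<in> sets P" by simp
      qed simp
      also have "\<dots> \<le> (\<integral>\<^sup>+\<omega>\<in>B. ennreal (Z 0 \<omega>) \<partial>P)"
        by (rule nonneg_supermartingale_maximal[OF sub mono Z step BF])
      also have "\<dots> \<le> (\<integral>\<^sup>+\<omega>. ennreal (real c) \<partial>P)"
        by (intro nn_integral_mono) (auto simp: B_def indicator_def intro: ennreal_leI)
      also have "\<dots> = ennreal (real c)" by (simp add: emeasure_space_1)
      finally have "ennreal (real j * prob (D c)) \<le> ennreal (real c)"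
        by (simp add: emeasure_eq_measure ennreal_mult)
      then show ?thesis by (simp add: ennreal_le_iff)
    qed
    show ?thesis
    proof (rule ccontr)
      assume "prob (D c) \<noteq> 0"
      then have pos: "prob (D c) > 0" by (simp add: zero_less_measure_iff)
      obtain j :: nat where "real c / prob (D c) < real j" using reals_Archimedean2 by blast
      then show False using bound[of j] pos by (simp add: field_simps)
    qed
  qed
  have "AE \<omega> in P. \<omega> \<notin> D c" for c
    by (rule AE_not_in) (use D0 DP in \<open>simp add: null_sets_def emeasure_eq_measure\<close>)
  then have "AE \<omega> in P. \<forall>c. \<omega> \<notin> D c" by (simp add: AE_all_countable)
  then show ?thesis using AE_space
  proof eventually_elim
    case (elim \<omega>)
    obtain c :: nat where "Z 0 \<omega> \<le> real c" using real_arch_simple by blast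
    moreover have "\<omega> \<notin> D c" using elim(1) by blast
    ultimately obtain j :: nat where "\<And>k. Z k \<omega> < real j" using elim(2) by (auto simp: D_def not_le)
    then show ?case by (intro bdd_aboveI[of _ "real j"]) (auto simp: less_imp_le)
  qed
qed

section \<open>Convergence of martingale transforms with summable conditional variances\<close>

lemma suminf_shift_Suc:
  fixes q :: "nat \<Rightarrow> real"
  assumes "summable q"
  shows "(\<Sum>j. q (j + n)) = q n + (\<Sum>j. q (j + Suc n))"
  using suminf_split_head[of "\<lambda>j. q (j + n)"] summable_ignore_initial_segment[OF assms, of n] by simp

lemma norm_add_scaleR_square:
  fixes u v :: "'a::real_inner"
  shows "(norm (u + r *\<^sub>R v))\<^sup>2 = (norm u)\<^sup>2 + 2 * r * (u \<bullet> v) + r\<^sup>2 * (norm v)\<^sup>2"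
  unfolding power2_norm_eq_inner
  by (simp add: inner_add_left inner_add_right inner_commute[of v u] power2_eq_square algebra_simps)

text \<open>The maximal inequality, restarted at each \<open>n\<close>, controls all later
  increments at once, with a bound that tends to 0 as \<open>n\<close> grows. This gives the Cauchy
  property of almost every path directly.\<close>

lemma martingale_transform_AE_summable:
  fixes M :: "nat \<Rightarrow> 'w \<Rightarrow> real ^ 'd" and b fy :: "nat \<Rightarrow> 'w \<Rightarrow> real"
  assumes P: "prob_space P"
    and sub: "\<And>n. subalgebra P (F n)" and mono: "\<And>n. sets (F n) \<subseteq> sets (F (Suc n))"
    and M: "\<And>n. M (Suc n) \<in> borel_measurable (F (Suc n))"
    and M2: "\<And>n. integrable P (\<lambda>\<omega>. (norm (M (Suc n) \<omega>))\<^sup>2)"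
    and M0: "\<And>n i. AE \<omega> in P. real_cond_exp P (F n) (\<lambda>\<omega>. M (Suc n) \<omega> $ i) \<omega> = 0"
    and Mf: "\<And>n. AE \<omega> in P. real_cond_exp P (F n) (\<lambda>\<omega>. (norm (M (Suc n) \<omega>))\<^sup>2) \<omega> \<le> fy n \<omega>"
    and b: "\<And>n. b n \<in> borel_measurable (F n)"
    and q: "\<And>n \<omega>. \<omega> \<in> space P \<Longrightarrow> (b n \<omega>)\<^sup>2 * fy n \<omega> \<le> q n" "\<And>n. q n \<ge> 0" "summable q"
  shows "AE \<omega> in P. summable (\<lambda>n. b n \<omega> *\<^sub>R M (Suc n) \<omega>)"
proof -
  interpret prob_space P by (rule P)
  have spF: "space (F n) = space P" for n using sub[of n] by (auto simp: subalgebra_def)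
  have mono': "sets (F n) \<subseteq> sets (F k)" if "n \<le> k" for n k
    using mono that by (rule lift_Suc_mono_le)
  have up: "f \<in> borel_measurable (F k)" if "f \<in> borel_measurable (F n)" "n \<le> k" for f :: "'w \<Rightarrow> 'c::topological_space" and n k
    using that mono'[OF that(2)] by (auto simp: measurable_def spF)
  have toP: "f \<in> borel_measurable P" if "f \<in> borel_measurable (F n)" for f :: "'w \<Rightarrow> 'c::topological_space" and n
    using measurable_from_subalg[OF sub that] .
  define S where "S n \<omega> = (\<Sum>k<n. b k \<omega> *\<^sub>R M (Suc k) \<omega>)" for n \<omega>
  have SF: "S n \<in> borel_measurable (F n)" for n
    unfolding S_def
    by (intro borel_measurable_sum borel_measurable_scaleR up[OF b] up[OF M]) auto
  note [measurable] = toP[OF SF]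
  define t where "t n = (\<Sum>j. q (j + n))" for n
  have tSuc: "t n = q n + t (Suc n)" for n unfolding t_def by (rule suminf_shift_Suc[OF q(3)])
  have t0: "t n \<ge> 0" for n unfolding t_def
    by (intro suminf_nonneg summable_ignore_initial_segment q)
  have tlim: "t \<longlonglongrightarrow> 0" unfolding t_def by (rule suminf_exist_split2[OF q(3)])
  have max: "c * prob {\<omega> \<in> space P. \<exists>k. (norm (S (n + k) \<omega> - S n \<omega>))\<^sup>2 \<ge> c} \<le> t n" if c: "c > 0" for c n
  proof -
    have DF: "(\<lambda>\<omega>. S (n + k) \<omega> - S n \<omega>) \<in> borel_measurable (F (n + k))" for k
      by (intro borel_measurable_diff SF up[OF SF]) auto
    have NF: "(\<lambda>\<omega>. (norm (S (n + k) \<omega> - S n \<omega>))\<^sup>2) \<in> borel_measurable (F (n + k))" for k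
      using measurable_compose[OF DF[of k] borel_measurable_norm] by (rule borel_measurable_power)
    \<comment> \<open>Adding the tail of the variance bounds turns the squared increment into a supermartingale.\<close>
    define Z where "Z k \<omega> = (norm (S (n + k) \<omega> - S n \<omega>))\<^sup>2 + t (n + k)" for k \<omega>
    have ZF: "Z k \<in> borel_measurable (F (n + k))" for k
      unfolding Z_def by (intro borel_measurable_add NF borel_measurable_const)
    note [measurable] = toP[OF ZF]
    have step: "(\<integral>\<^sup>+\<omega>\<in>A. ennreal (Z (Suc k) \<omega>) \<partial>P) \<le> (\<integral>\<^sup>+\<omega>\<in>A. ennreal (Z k \<omega>) \<partial>P)" if A: "A \<in> sets (F (n + k))" for k A
    proof (rule conditional_one_step[where F = "F (n + k)" and M' = "M (Suc (n + k))" and fy = "fy (n + k)"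
          and \<beta> = "\<lambda>\<omega>. (b (n + k) \<omega>)\<^sup>2" and \<xi> = "\<lambda>\<omega>. (2 * b (n + k) \<omega>) *\<^sub>R (S (n + k) \<omega> - S n \<omega>)"
            and V = "\<lambda>\<omega>. (norm (S (n + k) \<omega> - S n \<omega>))\<^sup>2 + t (Suc (n + k))"])
      show "prob_space P" "subalgebra P (F (n + k))" "A \<in> sets (F (n + k))" by (fact P sub A)+
      show "M (Suc (n + k)) \<in> borel_measurable P" "integrable P (\<lambda>\<omega>. (norm (M (Suc (n + k)) \<omega>))\<^sup>2)"
        by (rule toP[OF M] M2)+
      show "AE \<omega> in P. real_cond_exp P (F (n + k)) (\<lambda>\<omega>. M (Suc (n + k)) \<omega> $ i) \<omega> = 0" for i by (rule M0)
      show "AE \<omega> in P. real_cond_exp P (F (n + k)) (\<lambda>\<omega>. (norm (M (Suc (n + k)) \<omega>))\<^sup>2) \<omega> \<le> fy (n + k) \<omega>" by (rule Mf)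
      show "(\<lambda>\<omega>. (norm (S (n + k) \<omega> - S n \<omega>))\<^sup>2 + t (Suc (n + k))) \<in> borel_measurable (F (n + k))"
        by (intro borel_measurable_add NF borel_measurable_const)
      show "(\<lambda>\<omega>. (2 * b (n + k) \<omega>) *\<^sub>R (S (n + k) \<omega> - S n \<omega>)) \<in> borel_measurable (F (n + k))"
        by (intro borel_measurable_scaleR borel_measurable_times b DF borel_measurable_const)
      show "(\<lambda>\<omega>. (b (n + k) \<omega>)\<^sup>2) \<in> borel_measurable (F (n + k))"
        by (intro borel_measurable_power b)
      show "Z (Suc k) \<in> borel_measurable P" "Z k \<in> borel_measurable P" by (rule toP[OF ZF])+
      fix \<omega> assume \<omega>: "\<omega> \<in> space P"
      show "0 \<le> (norm (S (n + k) \<omega> - S n \<omega>))\<^sup>2 + t (Suc (n + k))" "0 \<le> (b (n + k) \<omega>)\<^sup>2" "0 \<le> Z (Suc k) \<omega>"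
        using t0 by (auto simp: Z_def)
      have inc: "S (Suc (n + k)) \<omega> - S n \<omega> = (S (n + k) \<omega> - S n \<omega>) + b (n + k) \<omega> *\<^sub>R M (Suc (n + k)) \<omega>"
        by (simp add: S_def)
      show "Z (Suc k) \<omega> \<le> (norm (S (n + k) \<omega> - S n \<omega>))\<^sup>2 + t (Suc (n + k))
          + (2 * b (n + k) \<omega>) *\<^sub>R (S (n + k) \<omega> - S n \<omega>) \<bullet> M (Suc (n + k)) \<omega>
          + (b (n + k) \<omega>)\<^sup>2 * (norm (M (Suc (n + k)) \<omega>))\<^sup>2"
        unfolding Z_def add_Suc_right inc norm_add_scaleR_square by simp
      show "(norm (S (n + k) \<omega> - S n \<omega>))\<^sup>2 + t (Suc (n + k)) + (b (n + k) \<omega>)\<^sup>2 * fy (n + k) \<omega> \<le> Z k \<omega>"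
        using q(1)[OF \<omega>, of "n + k"] tSuc[of "n + k"] by (simp add: Z_def)
    qed
    have "ennreal c * emeasure P {\<omega> \<in> space P. \<exists>k. Z k \<omega> \<ge> c} \<le> (\<integral>\<^sup>+\<omega>\<in>space P. ennreal (Z 0 \<omega>) \<partial>P)"
    proof (rule nonneg_supermartingale_maximal[where F = "\<lambda>k. F (n + k)"])
      show "space P \<in> sets (F (n + 0))" using sets.top[of "F n"] by (simp add: spF)
      show "sets (F (n + k)) \<subseteq> sets (F (n + Suc k))" for k using mono[of "n + k"] by simp
    qed (fact sub ZF step)+
    also have "\<dots> = (\<integral>\<^sup>+\<omega>. ennreal (t n) \<partial>P)" by (intro nn_integral_cong) (simp add: Z_def)
    also have "\<dots> = ennreal (t n)" by (simp add: emeasure_space_1)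
    finally have "ennreal (c * prob {\<omega> \<in> space P. \<exists>k. Z k \<omega> \<ge> c}) \<le> ennreal (t n)"
      using c by (simp add: emeasure_eq_measure ennreal_mult)
    then have "c * prob {\<omega> \<in> space P. \<exists>k. Z k \<omega> \<ge> c} \<le> t n" using t0 by (simp add: ennreal_le_iff)
    moreover have "prob {\<omega> \<in> space P. \<exists>k. (norm (S (n + k) \<omega> - S n \<omega>))\<^sup>2 \<ge> c} \<le> prob {\<omega> \<in> space P. \<exists>k. Z k \<omega> \<ge> c}"
    proof (rule finite_measure_mono)
      show "{\<omega> \<in> space P. \<exists>k. (norm (S (n + k) \<omega> - S n \<omega>))\<^sup>2 \<ge> c} \<subseteq> {\<omega> \<in> space P. \<exists>k. Z k \<omega> \<ge> c}"
        unfolding Z_def using t0 by (auto intro: add_increasing2)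
    qed simp
    ultimately show ?thesis using mult_left_mono[OF _ less_imp_le[OF c]] by fastforce
  qed
  \<comment> \<open>Paths that violate the Cauchy property at scale \<open>i\<close>. For every
    \<open>n\<close> the event lies inside the one estimated by \<open>max\<close>, so its
    probability is below every \<open>t n\<close> up to a fixed factor.\<close>
  define D where "D i = {\<omega> \<in> space P. \<forall>n. \<exists>k. (norm (S (n + k) \<omega> - S n \<omega>))\<^sup>2 \<ge> 1 / real (Suc i)}" for i
  have DP [measurable]: "D i \<in> sets P" for i unfolding D_def by measurable
  have "prob (D i) = 0" for i
  proof -
    have "1 / real (Suc i) * prob (D i) \<le> t n" for n
    proof (rule order_trans[OF mult_left_mono max[of "1 / real (Suc i)" n]])
      show "prob (D i) \<le> prob {\<omega> \<in> space P. \<exists>k. (norm (S (n + k) \<omega> - S n \<omega>))\<^sup>2 \<ge> 1 / real (Suc i)}"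
        by (rule finite_measure_mono) (auto simp: D_def)
    qed auto
    then have "1 / real (Suc i) * prob (D i) \<le> 0"
      by (intro LIMSEQ_le_const[OF tlim]) auto
    then show ?thesis by (simp add: divide_le_0_iff measure_le_0_iff)
  qed
  then have "AE \<omega> in P. \<omega> \<notin> D i" for i
    by (intro AE_not_in) (use DP in \<open>simp add: null_sets_def emeasure_eq_measure\<close>)
  then have "AE \<omega> in P. \<forall>i. \<omega> \<notin> D i" by (simp add: AE_all_countable)
  then show ?thesis using AE_space
  proof eventually_elim
    case (elim \<omega>)
    have "Cauchy (\<lambda>n. S n \<omega>)"
    proof (rule metric_CauchyI)
      fix e :: real assume e: "e > 0"
      obtain i :: nat where "1 / real (Suc i) < (e / 2)\<^sup>2"
        using reals_Archimedean[of "(e / 2)\<^sup>2"] e by (auto simp: inverse_eq_divide)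
      moreover obtain n where "\<And>k. (norm (S (n + k) \<omega> - S n \<omega>))\<^sup>2 < 1 / real (Suc i)"
        using elim unfolding D_def by (auto simp: not_le)
      ultimately have "(norm (S (n + k) \<omega> - S n \<omega>))\<^sup>2 < (e / 2)\<^sup>2" for k using less_trans by blast
      then have n: "norm (S (n + k) \<omega> - S n \<omega>) < e / 2" for k
        by (rule power_less_imp_less_base) (use e in simp)
      have "dist (S k \<omega>) (S l \<omega>) < e" if "k \<ge> n" "l \<ge> n" for k l
      proof (rule dist_triangle_half_l)
        show "dist (S k \<omega>) (S n \<omega>) < e / 2" "dist (S l \<omega>) (S n \<omega>) < e / 2"
          using n[of "k - n"] n[of "l - n"] that by (simp_all add: dist_norm)
      qed
      then show "\<exists>N. \<forall>k\<ge>N. \<forall>l\<ge>N. dist (S k \<omega>) (S l \<omega>) < e" by blast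
    qed
    then show ?case
      unfolding summable_iff_convergent S_def by (rule Cauchy_convergent)
  qed
qed

section \<open>The filtration generated by the initial value and the noise\<close>

lemma sets_noise_filtration:
  "sets (noise_filtration P Y M n) = sigma_sets (space P) ({Y -` B \<inter> space P | B. B \<in> sets borel} \<union>
      (\<Union>k\<in>{1..n}. {M k -` B \<inter> space P | B. B \<in> sets borel}))"
  unfolding noise_filtration_def by (rule sets_measure_of) auto

lemma noise_filtration_subalgebra:
  fixes M :: "nat \<Rightarrow> 'w \<Rightarrow> 'a::topological_space"
  assumes "Y \<in> borel_measurable P" "\<And>n. n \<ge> 1 \<Longrightarrow> M n \<in> borel_measurable P"
  shows "subalgebra P (noise_filtration P Y M n)"
proof -
  have "{Y -` B \<inter> space P | B. B \<in> sets borel} \<union>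
      (\<Union>k\<in>{1..n}. {M k -` B \<inter> space P | B. B \<in> sets borel}) \<subseteq> sets P"
    using assms by (auto intro: measurable_sets)
  from sets.sigma_sets_subset[OF this] show ?thesis
    unfolding subalgebra_def sets_noise_filtration by (simp add: noise_filtration_def space_measure_of_conv)
qed

lemma sets_noise_filtration_Suc: "sets (noise_filtration P Y M n) \<subseteq> sets (noise_filtration P Y M (Suc n))"
  unfolding sets_noise_filtration by (intro sigma_sets_subseteq Un_mono UN_mono) auto

lemma measurable_noise_filtration:
  shows "Y \<in> borel_measurable (noise_filtration P Y M n)"
    and "1 \<le> k \<Longrightarrow> k \<le> n \<Longrightarrow> M k \<in> borel_measurable (noise_filtration P Y M n)"
proof -
  note B = sigma_sets.Basic[OF UnI1] sigma_sets.Basic[OF UnI2]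
  have sp: "space (noise_filtration P Y M n) = space P" by (simp add: noise_filtration_def space_measure_of_conv)
  show "Y \<in> borel_measurable (noise_filtration P Y M n)"
    by (rule measurableI) (simp_all only: sp sets_noise_filtration UNIV_I space_borel, rule B(1), blast)
  show "M k \<in> borel_measurable (noise_filtration P Y M n)" if "1 \<le> k" "k \<le> n"
    by (rule measurableI)
       (simp_all only: sp sets_noise_filtration UNIV_I space_borel, rule B(2), use that in force)
qed

section \<open>Almost sure convergence\<close>

theorem theorem14:
  fixes P :: "'w measure"
    and h :: "real ^ 'd \<Rightarrow> real ^ 'd"
    and a :: "nat \<Rightarrow> real"
    and W :: "real ^ 'd \<Rightarrow> real"
    and gradW :: "real ^ 'd \<Rightarrow> real ^ 'd"
    and hessW :: "real ^ 'd \<Rightarrow> real ^ 'd ^ 'd"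
    and M :: "nat \<Rightarrow> 'w \<Rightarrow> real ^ 'd"
    and f g :: "real ^ 'd \<Rightarrow> real"
    and m :: nat and N :: enat and c\<^sub>N :: real
    and y :: "nat \<Rightarrow> 'w \<Rightarrow> real ^ 'd"
  assumes prob: "prob_space P"
    and y0: "y 0 \<in> borel_measurable P"
    and M: "\<And>n. n \<ge> 1 \<Longrightarrow> M n \<in> borel_measurable P"
    and a_pos: "\<And>n. a n > 0"
    and A1: "local_lipschitz (UNIV :: real set) UNIV (\<lambda>_. h)"
    and A2_i: "filterlim (\<lambda>n. \<Sum>k<n. a k) at_top sequentially"
    and A2_ii: "summable (\<lambda>n. (a n)\<^sup>2)"
    and A3_i: "\<And>n i. AE \<omega> in P.
        real_cond_exp P (noise_filtration P (y 0) M n) (\<lambda>\<omega>. M (Suc n) \<omega> $ i) \<omega> = 0"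
    and square_integrable: "\<And>n. n \<ge> 1 \<Longrightarrow> integrable P (\<lambda>\<omega>. (norm (M n \<omega>))\<^sup>2)"
    and f: "f \<in> borel_measurable borel" "locally_bounded f" "\<And>x. f x \<ge> 0"
    and A3_ii: "\<And>n. AE \<omega> in P.
        real_cond_exp P (noise_filtration P (y 0) M n) (\<lambda>\<omega>. (norm (M (Suc n) \<omega>))\<^sup>2) \<omega>
          \<le> f (y n \<omega>)"
    and A4_i: "\<And>x. W x \<ge> 0" "filterlim W at_top at_infinity"
    and A4_ii: "m > 0" "\<And>x. W x \<ge> real m \<Longrightarrow> h x \<bullet> gradW x < 0"
    and W_C1: "\<And>x. GDERIV W x :> gradW x" "continuous_on UNIV gradW"
    and A5_C2: "\<And>x. (gradW has_derivative (\<lambda>v. hessW x *v v)) (at x)"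
        "continuous_on UNIV hessW"
    and A5_bounded: "\<exists>C. \<forall>x i j. \<bar>hessW x $ i $ j\<bar> \<le> C"
    and N: "enat m < N"
    and c\<^sub>N: "max 1 (SUP z \<in> closure (sublevel W (ereal_of_enat N)) - sublevel W (ereal (real m)).
              ereal (((norm (h z))\<^sup>2 + f z) / W z)) < ereal c\<^sub>N"
    and g: "g \<in> borel_measurable borel" "locally_bounded g"
        "\<And>z. g z \<ge> max 1 (if ereal (W z) > ereal_of_enat N
                            then sqrt (((norm (h z))\<^sup>2 + f z) / W z) else 0)"
    and iterates: "\<And>n \<omega>. \<omega> \<in> space P \<Longrightarrow>
        y (Suc n) \<omega> = y n \<omega> + (a n / g (y n \<omega>)) *\<^sub>R (h (y n \<omega>) + M (Suc n) \<omega>)"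
  shows "AE \<omega> in P. \<exists>A. internally_chain_transitive h A \<and>
           (\<lambda>n. infdist (y n \<omega>) A) \<longlonglongrightarrow> 0"
proof -
  interpret prob_space P by (rule prob)
  define F where "F n = noise_filtration P (y 0) M n" for n
  have sub: "subalgebra P (F n)" for n
    unfolding F_def by (rule noise_filtration_subalgebra[OF y0 M])
  have spF: "space (F n) = space P" for n using sub[of n] by (auto simp: subalgebra_def)
  have mono: "sets (F n) \<subseteq> sets (F (Suc n))" for n unfolding F_def by (rule sets_noise_filtration_Suc)
  have up: "u \<in> borel_measurable (F (Suc n))" if "u \<in> borel_measurable (F n)" for u :: "'w \<Rightarrow> real ^ 'd" and n
    using that mono[of n] by (auto simp: measurable_def spF)
  have MF: "M (Suc n) \<in> borel_measurable (F (Suc n))" for n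
    unfolding F_def by (rule measurable_noise_filtration) auto
  have h: "continuous_on UNIV h" using local_lipschitz_continuous_on[OF A1] by blast
  have hb [measurable]: "h \<in> borel_measurable borel" using h by (rule borel_measurable_continuous_onI)
  note [measurable] = f(1) g(1)
  have Gb [measurable]: "gradW \<in> borel_measurable borel" using W_C1(2) by (rule borel_measurable_continuous_onI)
  have "continuous_on UNIV W"
    using W_C1(1) by (intro continuous_at_imp_continuous_on) (auto simp: gderiv_def intro: has_derivative_continuous)
  then have Wb [measurable]: "W \<in> borel_measurable borel" by (rule borel_measurable_continuous_onI)
  have yF: "y n \<in> borel_measurable (F n)" for n
  proof (induction n)
    case 0
    show ?case unfolding F_def by (rule measurable_noise_filtration)
  next
    case (Suc n)
    note [measurable] = up[OF Suc] MF[of n]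
    have "(\<lambda>\<omega>. y n \<omega> + (a n / g (y n \<omega>)) *\<^sub>R (h (y n \<omega>) + M (Suc n) \<omega>)) \<in> borel_measurable (F (Suc n))"
      by measurable
    then show ?case by (rule measurable_cong[THEN iffD1, rotated]) (simp add: iterates spF)
  qed
  have g1: "g z \<ge> 1" for z using g(3)[of z] by simp
  have clip_meas: "clip \<in> borel_measurable borel" unfolding clip_def by measurable
  have huber_meas: "huber \<in> borel_measurable borel" unfolding huber_def using clip_meas by measurable
  note [measurable] = clip_meas huber_meas
  obtain C2 where C2: "\<And>x i j. \<bar>hessW x $ i $ j\<bar> \<le> C2" using A5_bounded by blast
  obtain K where K: "K > 0" "\<And>x z. norm (gradW x - gradW z) \<le> K * norm (x - z)"
    using bounded_hessian_imp_lipschitz_gradient[OF A5_C2(1) C2] by blast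
  obtain K' where K': "K' > 0" and lyap: "\<And>x v. huber (W (x + v) - real m)
      \<le> huber (W x - real m) + clip (W x - real m) * (gradW x \<bullet> v) + K' * (norm v)\<^sup>2"
    using huber_lyapunov_step[OF W_C1(1) K(2,1) A4_i(1), of "real m"] by auto
  obtain C where C: "C > 0" and growth: "\<And>z. (norm (h z))\<^sup>2 + f z \<le> C * (g z)\<^sup>2 * (1 + W z)"
    using scaled_growth_bound[OF h f(2,3) A4_i A4_ii(1) N c\<^sub>N g(3)] by blast
  define V where "V x = huber (W x - real m)" for x
  define al where "al n \<omega> = a n / g (y n \<omega>)" for n \<omega>
  \<comment> \<open>The factor 2 comes from splitting the square of \<open>h + M\<close>,
    \<open>K'\<close> from the quadratic remainder, \<open>C\<close> from the growth bound, and
    \<open>m + 2\<close> from comparing \<open>1 + W\<close> with \<open>1 + V\<close>.\<close>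
  define Q where "Q = 2 * K' * C * (real m + 2)"
  have Q0: "Q > 0" using K' C by (simp add: Q_def)
  have V0: "V x \<ge> 0" for x by (simp add: V_def huber_nonneg)
  have al_pos: "al n \<omega> > 0" for n \<omega> using a_pos[of n] g1[of "y n \<omega>"] by (simp add: al_def)
  have al_le: "al n \<omega> \<le> a n" for n \<omega>
    using a_pos[of n] g1[of "y n \<omega>"] mult_left_mono[OF g1[of "y n \<omega>"], of "a n"]
    by (simp add: al_def divide_le_eq)
  have al_sq: "(al n \<omega>)\<^sup>2 \<le> (a n)\<^sup>2" for n \<omega>
    using al_le[of n \<omega>] al_pos[of n \<omega>] by (intro power_mono) auto
  have WV: "1 + W x \<le> (real m + 2) * (1 + V x)" for x
  proof -
    have "W x \<le> V x + real m + 1 / 2" using le_huber[of "W x - real m"] by (simp add: V_def)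
    moreover have "(real m + 2) * (1 + V x) = real m + 2 + V x + (real m + 1) * V x" by (simp add: algebra_simps)
    moreover have "(real m + 1) * V x \<ge> 0" using V0[of x] by simp
    ultimately show ?thesis by linarith
  qed
  have drift: "2 * K' * (al n \<omega>)\<^sup>2 * ((norm (h (y n \<omega>)))\<^sup>2 + f (y n \<omega>)) \<le> Q * (a n)\<^sup>2 * (1 + V (y n \<omega>))" for n \<omega>
  proof -
    have "2 * K' * (al n \<omega>)\<^sup>2 * ((norm (h (y n \<omega>)))\<^sup>2 + f (y n \<omega>))
        \<le> 2 * K' * (al n \<omega>)\<^sup>2 * (C * (g (y n \<omega>))\<^sup>2 * (1 + W (y n \<omega>)))"
      using K' growth by (intro mult_left_mono) auto
    \<comment> \<open>Here the adaptation pays off: the square of \<open>g\<close> in the growth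
      bound cancels against the step size.\<close>
    also have "\<dots> = 2 * K' * C * (a n)\<^sup>2 * (1 + W (y n \<omega>))"
      using g1[of "y n \<omega>"] by (simp add: al_def power_divide)
    also have "\<dots> \<le> 2 * K' * C * (a n)\<^sup>2 * ((real m + 2) * (1 + V (y n \<omega>)))"
      using K' C WV by (intro mult_left_mono) auto
    also have "\<dots> = Q * (a n)\<^sup>2 * (1 + V (y n \<omega>))" unfolding Q_def by (simp only: mult_ac)
    finally show ?thesis .
  qed
  have descent: "V (y (Suc n) \<omega>) \<le> V (y n \<omega>) + 2 * K' * (al n \<omega>)\<^sup>2 * (norm (h (y n \<omega>)))\<^sup>2
      + (al n \<omega> * clip (W (y n \<omega>) - real m)) *\<^sub>R gradW (y n \<omega>) \<bullet> M (Suc n) \<omega>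
      + 2 * K' * (al n \<omega>)\<^sup>2 * (norm (M (Suc n) \<omega>))\<^sup>2" if \<omega>: "\<omega> \<in> space P" for n \<omega>
  proof -
    let ?x = "y n \<omega>" and ?M = "M (Suc n) \<omega>" and ?c = "clip (W (y n \<omega>) - real m)" and ?al = "al n \<omega>"
    \<comment> \<open>Above the level \<open>m\<close> the drift is negative, and below it the slope
      vanishes.\<close>
    have ch: "?c * (gradW ?x \<bullet> h ?x) \<le> 0"
    proof (cases "W ?x \<ge> real m")
      case True
      then show ?thesis using A4_ii(2)[OF True] clip_bounds(1)[of "W ?x - real m"]
        by (simp add: mult_nonneg_nonpos inner_commute)
    next
      case False
      then show ?thesis by (simp add: clip_def)
    qed
    have "(norm (h ?x + ?M))\<^sup>2 \<le> (norm (h ?x) + norm ?M)\<^sup>2"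
      by (intro power_mono norm_triangle_ineq) auto
    also have "\<dots> \<le> 2 * ((norm (h ?x))\<^sup>2 + (norm ?M)\<^sup>2)"
      using sum_squares_bound[of "norm (h ?x)" "norm ?M"] by (simp add: power2_sum)
    finally have sq: "K' * ?al\<^sup>2 * (norm (h ?x + ?M))\<^sup>2 \<le> K' * ?al\<^sup>2 * (2 * ((norm (h ?x))\<^sup>2 + (norm ?M)\<^sup>2))"
      using K' by (intro mult_left_mono) auto
    have "V (y (Suc n) \<omega>) \<le> V ?x + ?c * (gradW ?x \<bullet> (?al *\<^sub>R (h ?x + ?M))) + K' * (norm (?al *\<^sub>R (h ?x + ?M)))\<^sup>2"
      unfolding V_def iterates[OF \<omega>] al_def by (rule lyap)
    also have "\<dots> = V ?x + ?al * (?c * (gradW ?x \<bullet> h ?x)) + (?al * ?c) *\<^sub>R gradW ?x \<bullet> ?M + K' * ?al\<^sup>2 * (norm (h ?x + ?M))\<^sup>2"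
    proof -
      have "(norm (?al *\<^sub>R (h ?x + ?M)))\<^sup>2 = ?al\<^sup>2 * (norm (h ?x + ?M))\<^sup>2"
        by (simp add: power_mult_distrib)
      moreover have "?c * (gradW ?x \<bullet> (?al *\<^sub>R (h ?x + ?M))) = ?al * (?c * (gradW ?x \<bullet> h ?x)) + (?al * ?c) *\<^sub>R gradW ?x \<bullet> ?M"
        by (simp add: inner_add_right algebra_simps)
      ultimately show ?thesis by (simp only: mult.assoc add.assoc)
    qed
    also have "\<dots> \<le> V ?x + 0 + (?al * ?c) *\<^sub>R gradW ?x \<bullet> ?M + K' * ?al\<^sup>2 * (2 * ((norm (h ?x))\<^sup>2 + (norm ?M)\<^sup>2))"
      using ch al_pos[of n \<omega>] by (intro add_mono sq order_refl) (simp add: mult_nonneg_nonpos)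
    finally show ?thesis by (simp add: algebra_simps)
  qed
  define pr where "pr n = (\<Prod>j<n. 1 + Q * (a j)\<^sup>2)" for n
  have pr0: "pr n > 0" for n
    unfolding pr_def using Q0 by (intro prod_pos) (simp add: add_pos_nonneg)
  \<comment> \<open>The error of one step is proportional to \<open>1 + V\<close>, so adding 1 turns
    the recursion into a purely multiplicative one.\<close>
  define Z where "Z n \<omega> = (1 + V (y n \<omega>)) / pr n" for n \<omega>
  have ZF: "Z n \<in> borel_measurable (F n)" for n
    unfolding Z_def V_def using yF[of n] by measurable
  have "AE \<omega> in P. bdd_above (range (\<lambda>n. Z n \<omega>))"
  proof (rule nonneg_supermartingale_AE_bdd_above[where F = F and Z = Z, OF prob sub mono ZF])
    fix n A assume A: "A \<in> sets (F n)"
    note yFn [measurable] = yF[of n]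
    show "(\<integral>\<^sup>+\<omega>\<in>A. ennreal (Z (Suc n) \<omega>) \<partial>P) \<le> (\<integral>\<^sup>+\<omega>\<in>A. ennreal (Z n \<omega>) \<partial>P)"
    proof (rule conditional_one_step[where F = "F n" and M' = "M (Suc n)" and fy = "\<lambda>\<omega>. f (y n \<omega>)"
          and \<beta> = "\<lambda>\<omega>. 2 * K' * (al n \<omega>)\<^sup>2 / pr (Suc n)"
          and \<xi> = "\<lambda>\<omega>. (al n \<omega> * clip (W (y n \<omega>) - real m) / pr (Suc n)) *\<^sub>R gradW (y n \<omega>)"
          and V = "\<lambda>\<omega>. (1 + V (y n \<omega>) + 2 * K' * (al n \<omega>)\<^sup>2 * (norm (h (y n \<omega>)))\<^sup>2) / pr (Suc n)"])
      show "prob_space P" "subalgebra P (F n)" "A \<in> sets (F n)" by (fact prob sub A)+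
      show "M (Suc n) \<in> borel_measurable P" "integrable P (\<lambda>\<omega>. (norm (M (Suc n) \<omega>))\<^sup>2)"
        by (rule M square_integrable; simp)+
      show "AE \<omega> in P. real_cond_exp P (F n) (\<lambda>\<omega>. M (Suc n) \<omega> $ i) \<omega> = 0" for i unfolding F_def by (rule A3_i)
      show "AE \<omega> in P. real_cond_exp P (F n) (\<lambda>\<omega>. (norm (M (Suc n) \<omega>))\<^sup>2) \<omega> \<le> f (y n \<omega>)"
        unfolding F_def by (rule A3_ii)
      show "(\<lambda>\<omega>. (1 + V (y n \<omega>) + 2 * K' * (al n \<omega>)\<^sup>2 * (norm (h (y n \<omega>)))\<^sup>2) / pr (Suc n)) \<in> borel_measurable (F n)"
        unfolding V_def al_def by measurable
      show "(\<lambda>\<omega>. (al n \<omega> * clip (W (y n \<omega>) - real m) / pr (Suc n)) *\<^sub>R gradW (y n \<omega>)) \<in> borel_measurable (F n)"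
        unfolding al_def by measurable
      show "(\<lambda>\<omega>. 2 * K' * (al n \<omega>)\<^sup>2 / pr (Suc n)) \<in> borel_measurable (F n)"
        unfolding al_def by measurable
      show "Z (Suc n) \<in> borel_measurable P" "Z n \<in> borel_measurable P"
        by (rule measurable_from_subalg[OF sub ZF])+
      fix \<omega> assume \<omega>: "\<omega> \<in> space P"
      show "0 \<le> (1 + V (y n \<omega>) + 2 * K' * (al n \<omega>)\<^sup>2 * (norm (h (y n \<omega>)))\<^sup>2) / pr (Suc n)"
        using V0 pr0[of "Suc n"] K' by (intro divide_nonneg_pos add_nonneg_nonneg) auto
      show "0 \<le> 2 * K' * (al n \<omega>)\<^sup>2 / pr (Suc n)" "0 \<le> Z (Suc n) \<omega>"
        using V0 pr0[of "Suc n"] K' by (auto simp: Z_def intro!: divide_nonneg_pos add_nonneg_nonneg)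
      have "Z (Suc n) \<omega> \<le> (1 + (V (y n \<omega>) + 2 * K' * (al n \<omega>)\<^sup>2 * (norm (h (y n \<omega>)))\<^sup>2
          + (al n \<omega> * clip (W (y n \<omega>) - real m)) *\<^sub>R gradW (y n \<omega>) \<bullet> M (Suc n) \<omega>
          + 2 * K' * (al n \<omega>)\<^sup>2 * (norm (M (Suc n) \<omega>))\<^sup>2)) / pr (Suc n)"
        unfolding Z_def using descent[OF \<omega>, of n] pr0[of "Suc n"] by (intro divide_right_mono add_left_mono) auto
      then show "Z (Suc n) \<omega> \<le> (1 + V (y n \<omega>) + 2 * K' * (al n \<omega>)\<^sup>2 * (norm (h (y n \<omega>)))\<^sup>2) / pr (Suc n)
          + (al n \<omega> * clip (W (y n \<omega>) - real m) / pr (Suc n)) *\<^sub>R gradW (y n \<omega>) \<bullet> M (Suc n) \<omega>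
          + 2 * K' * (al n \<omega>)\<^sup>2 / pr (Suc n) * (norm (M (Suc n) \<omega>))\<^sup>2"
        by (simp add: add_divide_distrib)
      \<comment> \<open>The new factor of \<open>pr\<close> is exactly the one by which this step
        may inflate \<open>1 + V\<close> in conditional mean.\<close>
      have "1 + V (y n \<omega>) + 2 * K' * (al n \<omega>)\<^sup>2 * (norm (h (y n \<omega>)))\<^sup>2 + 2 * K' * (al n \<omega>)\<^sup>2 * f (y n \<omega>)
          \<le> (1 + V (y n \<omega>)) * (1 + Q * (a n)\<^sup>2)"
        using drift[of n \<omega>] by (simp add: algebra_simps)
      then have "(1 + V (y n \<omega>) + 2 * K' * (al n \<omega>)\<^sup>2 * (norm (h (y n \<omega>)))\<^sup>2 + 2 * K' * (al n \<omega>)\<^sup>2 * f (y n \<omega>)) / pr (Suc n)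
          \<le> (1 + V (y n \<omega>)) * (1 + Q * (a n)\<^sup>2) / pr (Suc n)"
        using pr0[of "Suc n"] by (intro divide_right_mono) auto
      also have "\<dots> = Z n \<omega>"
      proof -
        have "pr (Suc n) = pr n * (1 + Q * (a n)\<^sup>2)" by (simp add: pr_def)
        moreover have "1 + Q * (a n)\<^sup>2 > 0" using Q0 by (simp add: add_pos_nonneg)
        ultimately show ?thesis by (simp add: Z_def)
      qed
      finally show "(1 + V (y n \<omega>) + 2 * K' * (al n \<omega>)\<^sup>2 * (norm (h (y n \<omega>)))\<^sup>2) / pr (Suc n)
          + 2 * K' * (al n \<omega>)\<^sup>2 / pr (Suc n) * f (y n \<omega>) \<le> Z n \<omega>"
        by (simp add: add_divide_distrib)
    qed
  qed
  \<comment> \<open>The cutoff depends on \<open>y n\<close> only, so the transform stays adapted,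
    and inside the ball \<open>f\<close> is bounded. Integer radii give one null set for all of
    them, as the radius needed depends on the path.\<close>
  moreover have "AE \<omega> in P. \<forall>R::nat. summable (\<lambda>n. (al n \<omega> * indicator (cball 0 (real R)) (y n \<omega>)) *\<^sub>R M (Suc n) \<omega>)"
    unfolding AE_all_countable
  proof
    fix R :: nat
    obtain b where b: "b > 0" "\<And>x. x \<in> cball 0 (real R) \<Longrightarrow> \<bar>f x\<bar> \<le> b"
      using locally_bounded_compact[OF f(2) compact_cball] by blast
    show "AE \<omega> in P. summable (\<lambda>n. (al n \<omega> * indicator (cball 0 (real R)) (y n \<omega>)) *\<^sub>R M (Suc n) \<omega>)"
    proof (rule martingale_transform_AE_summable[where F = F and M = M, OF prob sub mono MF,
          where fy = "\<lambda>n \<omega>. f (y n \<omega>)" and q = "\<lambda>n. (a n)\<^sup>2 * b"])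
      show "integrable P (\<lambda>\<omega>. (norm (M (Suc n) \<omega>))\<^sup>2)" for n by (rule square_integrable) simp
      show "AE \<omega> in P. real_cond_exp P (F n) (\<lambda>\<omega>. M (Suc n) \<omega> $ i) \<omega> = 0" for n i unfolding F_def by (rule A3_i)
      show "AE \<omega> in P. real_cond_exp P (F n) (\<lambda>\<omega>. (norm (M (Suc n) \<omega>))\<^sup>2) \<omega> \<le> f (y n \<omega>)" for n
        unfolding F_def by (rule A3_ii)
      show "(\<lambda>\<omega>. al n \<omega> * indicator (cball 0 (real R)) (y n \<omega>)) \<in> borel_measurable (F n)" for n
      proof (rule borel_measurable_times)
        show "al n \<in> borel_measurable (F n)" unfolding al_def using yF[of n] by measurable
        show "(\<lambda>\<omega>. indicator (cball 0 (real R)) (y n \<omega>) :: real) \<in> borel_measurable (F n)"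
          by (rule measurable_compose[OF yF borel_measurable_indicator]) simp
      qed
      show "(al n \<omega> * indicator (cball 0 (real R)) (y n \<omega>))\<^sup>2 * f (y n \<omega>) \<le> (a n)\<^sup>2 * b" for n \<omega>
      proof (cases "y n \<omega> \<in> cball 0 (real R)")
        case True
        have "(al n \<omega>)\<^sup>2 * f (y n \<omega>) \<le> (a n)\<^sup>2 * b"
          using b(2)[OF True] f(3) by (intro mult_mono al_sq) auto
        then show ?thesis using True by simp
      next
        case False
        then show ?thesis using b(1) by simp
      qed
      show "(a n)\<^sup>2 * b \<ge> 0" for n using b(1) by simp
      show "summable (\<lambda>n. (a n)\<^sup>2 * b)" by (rule summable_mult2[OF A2_ii])
    qed
  qed
  ultimately show ?thesis using AE_space
  proof eventually_elim
    case (elim \<omega>)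
    obtain c where c: "\<And>n. Z n \<omega> \<le> c" using elim(1) by (auto simp: bdd_above_def)
    have c0: "c \<ge> 0" using c[of 0] V0[of "y 0 \<omega>"] by (simp add: Z_def pr_def)
    \<comment> \<open>The products stay bounded because the squares of the steps are summable, so a
      bounded \<open>Z\<close> yields a bounded \<open>V\<close>.\<close>
    have prb: "pr n \<le> exp (Q * (\<Sum>j. (a j)\<^sup>2))" for n
    proof -
      have "pr n \<le> (\<Prod>j<n. exp (Q * (a j)\<^sup>2))"
        unfolding pr_def using Q0 by (intro prod_mono) (auto simp: exp_ge_add_one_self add_nonneg_nonneg)
      also have "\<dots> = exp (Q * (\<Sum>j<n. (a j)\<^sup>2))" by (simp add: exp_sum sum_distrib_left)
      also have "\<dots> \<le> exp (Q * (\<Sum>j. (a j)\<^sup>2))"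
        using Q0 A2_ii by (simp add: sum_le_suminf)
      finally show ?thesis .
    qed
    define w where "w = (real m + 2) * (c * exp (Q * (\<Sum>j. (a j)\<^sup>2)))"
    have "W (y n \<omega>) \<le> w" for n
    proof -
      have "1 + V (y n \<omega>) \<le> c * pr n" using c[of n] pr0[of n] by (simp add: Z_def divide_le_eq)
      also have "\<dots> \<le> c * exp (Q * (\<Sum>j. (a j)\<^sup>2))" using c0 prb by (intro mult_left_mono) auto
      finally have "(real m + 2) * (1 + V (y n \<omega>)) \<le> w" unfolding w_def by (intro mult_left_mono) auto
      then show ?thesis using WV[of "y n \<omega>"] by linarith
    qed
    then obtain R0 where "\<And>n. norm (y n \<omega>) \<le> R0"
      using bounded_sublevel_at_infinity[OF A4_i(2), where r = w] by metis
    moreover obtain R :: nat where "R0 \<le> real R" using real_arch_simple by blast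
    ultimately have R: "norm (y n \<omega>) \<le> real R" for n using order_trans by blast
    \<comment> \<open>For this radius the cutoff is inactive at every index of the path, so the
      cut-off sum is the actual noise sum.\<close>
    then have ind: "indicator (cball 0 (real R)) (y n \<omega>) = (1::real)" for n by simp
    \<comment> \<open>On a bounded path \<open>g\<close> is bounded, so the adapted steps are at
      least a fixed fraction of the original ones and their sum still diverges.\<close>
    obtain b where b: "b > 0" "\<And>x. x \<in> cball 0 (real R) \<Longrightarrow> \<bar>g x\<bar> \<le> b"
      using locally_bounded_compact[OF g(2) compact_cball] by blast
    have al_ge: "a n / b \<le> al n \<omega>" for n
      using b(2)[of "y n \<omega>"] R[of n] g1[of "y n \<omega>"] a_pos[of n] unfolding al_def
      by (intro divide_left_mono) auto
    show ?case
    proof (rule perturbed_euler_limit_set[OF A1, where al = "\<lambda>n. al n \<omega>" and u = "\<lambda>n. al n \<omega> *\<^sub>R M (Suc n) \<omega>"])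
      show "0 < al n \<omega>" for n by (rule al_pos)
      show "filterlim (\<lambda>n. \<Sum>k<n. al k \<omega>) at_top sequentially"
      proof (rule filterlim_at_top_mono)
        show "filterlim (\<lambda>n. (1 / b) * (\<Sum>k<n. a k)) at_top sequentially"
          using b(1) by (intro filterlim_tendsto_pos_mult_at_top[OF tendsto_const _ A2_i]) auto
        show "\<forall>\<^sub>F n in sequentially. (1 / b) * (\<Sum>k<n. a k) \<le> (\<Sum>k<n. al k \<omega>)"
          using al_ge by (intro always_eventually allI) (simp add: sum_divide_distrib sum_mono)
      qed
      show "summable (\<lambda>n. (al n \<omega>)\<^sup>2)"
        using A2_ii by (rule summable_comparison_test'[where N = 0]) (simp add: al_sq)
      show "y (Suc n) \<omega> = y n \<omega> + al n \<omega> *\<^sub>R h (y n \<omega>) + al n \<omega> *\<^sub>R M (Suc n) \<omega>" for n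
        using iterates[OF elim(3), of n] by (simp add: al_def scaleR_add_right add.assoc)
      show "summable (\<lambda>n. al n \<omega> *\<^sub>R M (Suc n) \<omega>)" using elim(2)[rule_format, of R] by (simp add: ind)
      show "bounded (range (\<lambda>n. y n \<omega>))" using R by (auto simp: bounded_iff)
    qed
  qed
qed

end
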